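(* Let $\mathrm{DC}_k$ denote the double circle with $k$ external and $k$ internal points, and let $|\mathfrak{T}(\mathrm{DC}_k)|$ be its number of triangulations. Then, as $k\to\infty$, \[ |\mathfrak{T}(\mathrm{DC}_k)| \sim \frac{54}{7\sqrt{\pi}}\,\frac{\sqrt{21}\,(5-\sqrt{21})}{(7-\sqrt{21})^2}\,12^{k-2}\,k^{-3/2}. \]
   Context: The double circle $\mathrm{DC}_k$ is the planar point set of $2k$ points consisting of the $k$ vertices $p_1,\dots,p_k$ of a convex $k$-gon together with, for each edge $p_ip_{i+1}$ (indices mod $k$), one point $q_i$ placed inside the polygon very close to the midpoint of that edge (close enough that the orientations of all triples of points, and hence everything below, do not depend on the exact placement). All point sets are in general position (no three collinear). A triangulation of a finite planar point set in general position is an inclusion-maximal set of segments with endpoints in the set such that no two segments cross (segments sharing an endpoint are not considered crossing). *)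

theory Defs
  imports "HOL-Analysis.Analysis" "HOL-Library.Landau_Symbols"
begin

type_synonym point = "real \<times> real"

definition segments :: "point set \<Rightarrow> point set set" where
  "segments S = {{a, b} | a b. a \<in> S \<and> b \<in> S \<and> a \<noteq> b}"

definition crosses :: "point set \<Rightarrow> point set \<Rightarrow> bool" where
  "crosses e f \<longleftrightarrow> e \<inter> f = {} \<and> convex hull e \<inter> convex hull f \<noteq> {}"

definition triangulation :: "point set \<Rightarrow> point set set \<Rightarrow> bool" where
  "triangulation S T \<longleftrightarrow>
     T \<subseteq> segments S \<and>
     (\<forall>e\<in>T. \<forall>f\<in>T. \<not> crosses e f) \<and>
     (\<forall>e\<in>segments S - T. \<exists>f\<in>T. crosses e f)"

definition triangulations :: "point set \<Rightarrow> point set set set" where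
  "triangulations S = {T. triangulation S T}"

text \<open>Outer points: vertices of the regular k-gon (indices mod k automatically,
  by periodicity of cos/sin).\<close>
definition dc_outer :: "nat \<Rightarrow> nat \<Rightarrow> point" where
  "dc_outer k i = (cos (2 * pi * real i / real k), sin (2 * pi * real i / real k))"

definition dc_inner :: "nat \<Rightarrow> real \<Rightarrow> nat \<Rightarrow> point" where
  "dc_inner k eps i = (1 - eps) *\<^sub>R midpoint (dc_outer k i) (dc_outer k (Suc i))"

definition double_circle :: "nat \<Rightarrow> real \<Rightarrow> point set" where
  "double_circle k eps = dc_outer k ` {..<k} \<union> dc_inner k eps ` {..<k}"

definition num_tri_DC :: "nat \<Rightarrow> nat" where
  "num_tri_DC k = (THE n. eventually (\<lambda>eps. card (triangulations (double_circle k eps)) = n)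
                                      (at_right 0))"

end

theory Submission
  imports Defs "HOL-Probability.Distributions" "HOL-Real_Asymp.Real_Asymp"
begin

text \<open>List the points of the double circle in cyclic order \<open>p\<^sub>0, q\<^sub>0, p\<^sub>1, q\<^sub>1, \<dots>\<close>.  Two segments
  cross exactly as in a convex \<open>2 k\<close>-gon, except that the hull edges \<open>p\<^sub>i p\<^sub>i\<^sub>+\<^sub>1\<close> cross nothing.
  Hence triangulations of the double circle correspond to triangulations of a convex \<open>2 k\<close>-gon in
  which no ear is cut off at any of the \<open>k\<close> vertices \<open>q\<^sub>i\<close>, and by inclusion--exclusion over these ears
  there are \<open>\<Sum>\<^sub>j (- 1)\<^sup>j (k choose j) C\<^bsub>2k-2-j\<^esub>\<close> of them.  Since the Catalan numbers are the moments
  \<open>C\<^sub>m = 4/\<pi> \<integral> x\<^sup>m sin\<^sup>2 t dt\<close> with \<open>x = 4 cos\<^sup>2 t\<close> over \<open>[0, \<pi>/2]\<close>, this number is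
  \<open>4/\<pi> \<integral> x\<^sup>k\<^sup>-\<^sup>2 (x - 1)\<^sup>k sin\<^sup>2 t dt\<close>.  Laplace's method at \<open>t = 0\<close>, where \<open>x (x - 1) = 12\<close>, gives
  the asymptotics.\<close>

subsection \<open>Maximal independent sets\<close>

definition maximal_independent :: "'a set \<Rightarrow> ('a \<Rightarrow> 'a \<Rightarrow> bool) \<Rightarrow> 'a set set" where
  "maximal_independent U R =
    {T \<in> Pow U. (\<forall>e\<in>T. \<forall>f\<in>T. \<not> R e f) \<and> (\<forall>e\<in>U - T. \<exists>f\<in>T. R e f)}"

lemma triangulations_eq_maximal_independent:
  "triangulations S = maximal_independent (segments S) crosses"
  by (auto simp: triangulations_def triangulation_def maximal_independent_def)

lemma finite_maximal_independent: "finite U \<Longrightarrow> finite (maximal_independent U R)"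
  by (simp add: maximal_independent_def)

lemma maximal_independent_subset: "T \<in> maximal_independent U R \<Longrightarrow> T \<subseteq> U"
  by (simp add: maximal_independent_def)

lemma maximal_independent_independent:
  "T \<in> maximal_independent U R \<Longrightarrow> e \<in> T \<Longrightarrow> f \<in> T \<Longrightarrow> \<not> R e f"
  by (simp add: maximal_independent_def)

lemma maximal_independent_maximal:
  "T \<in> maximal_independent U R \<Longrightarrow> e \<in> U \<Longrightarrow> (\<And>f. f \<in> T \<Longrightarrow> \<not> R e f) \<Longrightarrow> e \<in> T"
  unfolding maximal_independent_def by blast

lemma card_maximal_independent_bij_betw:
  assumes bij: "bij_betw E U V"
    and iff: "\<And>e f. e \<in> U \<Longrightarrow> f \<in> U \<Longrightarrow> S (E e) (E f) \<longleftrightarrow> R e f"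
  shows "card (maximal_independent V S) = card (maximal_independent U R)"
proof -
  have "bij_betw ((`) E) (maximal_independent U R) (maximal_independent V S)"
    unfolding maximal_independent_def
  proof (rule bij_betw_Collect[OF bij_betw_image_Pow[OF bij]])
    fix T assume "T \<in> Pow U"
    then have T: "T \<subseteq> U" by simp
    have compl: "V - E ` T = E ` (U - T)"
      using bij T inj_on_image_set_diff[of E U U T] by (simp add: bij_betw_def)
    have "(\<forall>e\<in>E ` T. \<forall>f\<in>E ` T. \<not> S e f) \<longleftrightarrow> (\<forall>e\<in>T. \<forall>f\<in>T. \<not> R e f)"
      using T iff by blast
    moreover have "(\<forall>e\<in>V - E ` T. \<exists>f\<in>E ` T. S e f) \<longleftrightarrow> (\<forall>e\<in>U - T. \<exists>f\<in>T. R e f)"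
      unfolding compl using T iff by blast
    ultimately show "((\<forall>e\<in>E ` T. \<forall>f\<in>E ` T. \<not> S e f) \<and> (\<forall>e\<in>V - E ` T. \<exists>f\<in>E ` T. S e f)) \<longleftrightarrow>
        ((\<forall>e\<in>T. \<forall>f\<in>T. \<not> R e f) \<and> (\<forall>e\<in>U - T. \<exists>f\<in>T. R e f))"
      by (rule arg_cong2)
  qed
  then show ?thesis by (simp add: bij_betw_same_card)
qed

lemma isolated_subset_maximal_independent:
  assumes "T \<in> maximal_independent U R" "Z \<subseteq> U" "\<And>e f. e \<in> Z \<Longrightarrow> f \<in> U \<Longrightarrow> \<not> R e f"
  shows "Z \<subseteq> T"
proof
  fix e assume "e \<in> Z"
  with assms show "e \<in> T"
    using maximal_independent_subset[OF assms(1)]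
    by (intro maximal_independent_maximal[OF assms(1)]) blast+
qed

lemma maximal_independent_Diff_isolated:
  assumes "T \<in> maximal_independent U R" "\<And>e f. e \<in> U \<Longrightarrow> f \<in> Z \<Longrightarrow> \<not> R e f"
  shows "T - Z \<in> maximal_independent (U - Z) R"
  using assms unfolding maximal_independent_def by blast

lemma maximal_independent_Un_isolated:
  assumes "T \<in> maximal_independent (U - Z) R" "Z \<subseteq> U"
    "\<And>e f. e \<in> Z \<Longrightarrow> f \<in> U \<Longrightarrow> \<not> R e f" "\<And>e f. e \<in> U \<Longrightarrow> f \<in> Z \<Longrightarrow> \<not> R e f"
  shows "T \<union> Z \<in> maximal_independent U R"
  using assms unfolding maximal_independent_def by blast

lemma card_maximal_independent_Diff_isolated:
  assumes Z: "Z \<subseteq> U" and sym: "\<And>e f. R e f \<longleftrightarrow> R f e"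
    and isolated: "\<And>e f. e \<in> Z \<Longrightarrow> f \<in> U \<Longrightarrow> \<not> R e f"
  shows "card (maximal_independent U R) = card (maximal_independent (U - Z) R)"
proof (rule bij_betw_same_card)
  have isolated': "\<not> R e f" if "e \<in> U" "f \<in> Z" for e f
    using isolated[OF that(2,1)] sym by blast
  show "bij_betw (\<lambda>T. T - Z) (maximal_independent U R) (maximal_independent (U - Z) R)"
  proof (rule bij_betwI[where g = "\<lambda>T. T \<union> Z"])
    show "T - Z \<union> Z = T" if "T \<in> maximal_independent U R" for T
      using isolated_subset_maximal_independent[OF that Z isolated] by blast
    show "T \<union> Z - Z = T" if "T \<in> maximal_independent (U - Z) R" for T
      using maximal_independent_subset[OF that] by blast
    show "(\<lambda>T. T - Z) \<in> maximal_independent U R \<rightarrow> maximal_independent (U - Z) R"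
      by (intro funcsetI maximal_independent_Diff_isolated isolated')
    show "(\<lambda>T. T \<union> Z) \<in> maximal_independent (U - Z) R \<rightarrow> maximal_independent U R"
      by (intro funcsetI maximal_independent_Un_isolated Z isolated isolated')
  qed
qed

subsection \<open>Catalan numbers and inclusion--exclusion\<close>

fun catalan :: "nat \<Rightarrow> nat" where
  "catalan 0 = 1"
| "catalan (Suc n) = (\<Sum>i\<le>n. catalan i * catalan (n - i))"

lemma catalan_convolution:
  fixes I :: "'a::wellorder set"
  assumes "finite I" "I \<noteq> {}"
  shows "(\<Sum>c\<in>I. catalan (card {x \<in> I. x < c}) * catalan (card {x \<in> I. c < x})) = catalan (card I)"
proof -
  obtain n where n: "card I = Suc n"
    using assms by (cases "card I") auto
  obtain h where bij: "bij_betw h {..<card I} I" and mono: "strict_mono_on {..<card I} h"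
    using ex_bij_betw_strict_mono_card[OF \<open>finite I\<close>] .
  have less_iff: "h i < h j \<longleftrightarrow> i < j" if "i < card I" "j < card I" for i j
    using strict_mono_on_less[OF mono] that by simp
  have I: "I = h ` {..<card I}" using bij by (simp add: bij_betw_def)
  have inj: "inj_on h A" if "A \<subseteq> {..<card I}" for A
    using bij that by (auto simp: bij_betw_def intro: inj_on_subset)
  have "card {x \<in> I. x < h i} = i" "card {x \<in> I. h i < x} = n - i" if "i \<le> n" for i
  proof -
    have "{x \<in> I. x < h i} = h ` {..<i}" "{x \<in> I. h i < x} = h ` {i<..<card I}"
      using that n less_iff by (subst I, force)+
    then show "card {x \<in> I. x < h i} = i" "card {x \<in> I. h i < x} = n - i"
      using that n inj by (simp_all add: card_image subset_iff)
  qed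
  then have "catalan (card I) =
      (\<Sum>i\<le>n. catalan (card {x \<in> I. x < h i}) * catalan (card {x \<in> I. h i < x}))"
    by (simp add: n)
  also have "\<dots> = (\<Sum>c\<in>I. catalan (card {x \<in> I. x < c}) * catalan (card {x \<in> I. c < x}))"
    using sum.reindex_bij_betw[OF bij] by (simp add: n lessThan_Suc_atMost)
  finally show ?thesis ..
qed

text \<open>Up to sign, the term for \<open>J\<close> counts the triangulations of a polygon with \<open>m + 2\<close> vertices in
  which the ears at the vertices of \<open>J\<close> are cut off.\<close>

definition ear_free_count :: "nat \<Rightarrow> 'a set \<Rightarrow> int" where
  "ear_free_count m B = (\<Sum>J\<in>Pow B. (-1) ^ card J * int (catalan (m - card J)))"

lemma ear_free_count_empty: "ear_free_count m {} = int (catalan m)"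
  by (simp add: ear_free_count_def)

lemma ear_free_count_insert:
  assumes "finite B" "q \<notin> B"
  shows "ear_free_count m (insert q B) = ear_free_count m B - ear_free_count (m - 1) B"
proof -
  let ?t = "\<lambda>J. (-1) ^ card J * int (catalan (m - card J))"
  have "(\<Sum>J\<in>insert q ` Pow B. ?t J) = (\<Sum>J\<in>Pow B. ?t (insert q J))"
    using assms by (subst sum.reindex) (auto simp: inj_on_def)
  also have "\<dots> = - ear_free_count (m - 1) B"
    unfolding ear_free_count_def sum_negf[symmetric]
  proof (rule sum.cong)
    fix J assume "J \<in> Pow B"
    then have "card (insert q J) = Suc (card J)"
      using assms finite_subset by (intro card_insert_disjoint) auto
    then show "?t (insert q J) = - ((-1) ^ card J * int (catalan (m - 1 - card J)))"
      by simp
  qed simp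
  finally have "(\<Sum>J\<in>insert q ` Pow B. ?t J) = - ear_free_count (m - 1) B" .
  moreover have "ear_free_count m (insert q B) = (\<Sum>J\<in>Pow B. ?t J) + (\<Sum>J\<in>insert q ` Pow B. ?t J)"
    unfolding ear_free_count_def Pow_insert using assms by (intro sum.union_disjoint) auto
  ultimately show ?thesis by (simp add: ear_free_count_def[of m B])
qed

lemma ear_free_count_mult:
  fixes I B :: "'a::linorder set"
  assumes "finite I" "B \<subseteq> I" "c \<in> I"
  shows "ear_free_count (card {x \<in> I. x < c}) {x \<in> B. x < c} *
      ear_free_count (card {x \<in> I. c < x}) {x \<in> B. c < x} =
    (\<Sum>J | J \<in> Pow B \<and> c \<notin> J. (-1) ^ card J *
      int (catalan (card {x \<in> I - J. x < c}) * catalan (card {x \<in> I - J. c < x})))"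
    (is "_ = (\<Sum>J | _. ?t J)")
proof -
  have "?t (K \<union> L) = ((-1) ^ card K * int (catalan (card {x \<in> I. x < c} - card K))) *
      ((-1) ^ card L * int (catalan (card {x \<in> I. c < x} - card L)))"
    if "K \<subseteq> {x \<in> B. x < c}" "L \<subseteq> {x \<in> B. c < x}" for K L
  proof -
    have sub: "K \<subseteq> {x \<in> I. x < c}" "L \<subseteq> {x \<in> I. c < x}" using that assms by auto
    then have fin: "finite K" "finite L" using assms(1) by (auto intro: finite_subset)
    have "K \<inter> L = {}" using that by force
    moreover have "{x \<in> I - (K \<union> L). x < c} = {x \<in> I. x < c} - K"
      "{x \<in> I - (K \<union> L). c < x} = {x \<in> I. c < x} - L" using that by auto
    ultimately show ?thesis
      using sub fin by (simp add: card_Un_disjoint card_Diff_subset power_add)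
  qed
  then have "ear_free_count (card {x \<in> I. x < c}) {x \<in> B. x < c} *
      ear_free_count (card {x \<in> I. c < x}) {x \<in> B. c < x} =
    (\<Sum>(K, L)\<in>Pow {x \<in> B. x < c} \<times> Pow {x \<in> B. c < x}. ?t (K \<union> L))"
    unfolding ear_free_count_def sum_product sum.cartesian_product
    by (intro sum.cong) auto
  also have "\<dots> = (\<Sum>J | J \<in> Pow B \<and> c \<notin> J. ?t J)"
    by (rule sum.reindex_bij_witness[where i = "\<lambda>J. ({x \<in> J. x < c}, {x \<in> J. c < x})"
          and j = "\<lambda>(K, L). K \<union> L"]) (auto simp: not_less le_less)
  finally show ?thesis .
qed

lemma ear_free_count_convolution:
  fixes I B :: "'a::wellorder set"
  assumes "finite I" "B \<subset> I"
  shows "(\<Sum>c\<in>I. ear_free_count (card {x \<in> I. x < c}) {x \<in> B. x < c} *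
      ear_free_count (card {x \<in> I. c < x}) {x \<in> B. c < x}) = ear_free_count (card I) B"
proof -
  let ?cat = "\<lambda>J c. catalan (card {x \<in> I - J. x < c}) * catalan (card {x \<in> I - J. c < x})"
  have fin: "finite (Pow B)" using assms by (auto intro: finite_subset)
  have "(\<Sum>c\<in>I. ear_free_count (card {x \<in> I. x < c}) {x \<in> B. x < c} *
        ear_free_count (card {x \<in> I. c < x}) {x \<in> B. c < x}) =
      (\<Sum>c\<in>I. \<Sum>J | J \<in> Pow B \<and> c \<notin> J. (-1) ^ card J * int (?cat J c))"
    using assms by (intro sum.cong refl ear_free_count_mult) auto
  also have "\<dots> = (\<Sum>J\<in>Pow B. \<Sum>c | c \<in> I \<and> c \<notin> J. (-1) ^ card J * int (?cat J c))"
    using assms(1) fin by (rule sum.swap_restrict)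
  also have "\<dots> = (\<Sum>J\<in>Pow B. (-1) ^ card J * int (\<Sum>c\<in>I - J. ?cat J c))"
    by (simp add: sum_distrib_left set_diff_eq)
  also have "\<dots> = ear_free_count (card I) B"
    unfolding ear_free_count_def
  proof (intro sum.cong refl)
    fix J assume "J \<in> Pow B"
    then have J: "J \<subset> I" using assms(2) by blast
    then have "finite J" using assms(1) by (auto intro: finite_subset)
    with J have "(\<Sum>c\<in>I - J. ?cat J c) = catalan (card I - card J)"
      using catalan_convolution[of "I - J"] assms(1) by (auto simp: card_Diff_subset)
    then show "(-1) ^ card J * int (\<Sum>c\<in>I - J. ?cat J c) =
        (-1) ^ card J * int (catalan (card I - card J))"
      by (simp only:)
  qed
  finally show ?thesis .
qed

subsection \<open>Triangulations of a convex polygon avoiding ears\<close>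

definition interleave :: "nat \<times> nat \<Rightarrow> nat \<times> nat \<Rightarrow> bool" where
  "interleave e f \<longleftrightarrow>
    fst e < fst f \<and> fst f < snd e \<and> snd e < snd f \<or>
    fst f < fst e \<and> fst e < snd f \<and> snd f < snd e"

lemma interleave_commute: "interleave e f \<longleftrightarrow> interleave f e"
  by (auto simp: interleave_def)

text \<open>The vertices are numbered so that \<open>0\<close> is unmarked; then only the ear at \<open>n - 1\<close> wraps around.\<close>

locale marked_polygon =
  fixes n :: nat and M :: "nat set"
  assumes four_le: "4 \<le> n"
    and marked_subset: "M \<subseteq> {0<..<n}"
    and not_adjacent: "q \<in> M \<Longrightarrow> Suc q \<notin> M"
begin

definition marked_ear :: "nat \<Rightarrow> nat \<Rightarrow> bool" where
  "marked_ear x y \<longleftrightarrow> y = x + 2 \<and> x + 1 \<in> M \<or> x = 0 \<and> y = n - 2 \<and> n - 1 \<in> M"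

definition chords :: "nat \<Rightarrow> nat \<Rightarrow> (nat \<times> nat) set" where
  "chords a b = {(x, y). a \<le> x \<and> x < y \<and> y \<le> b \<and> \<not> marked_ear x y}"

definition dissections :: "nat \<Rightarrow> nat \<Rightarrow> (nat \<times> nat) set set" where
  "dissections a b = maximal_independent (chords a b) interleave"

lemma Suc_diff_two: "Suc (n - 2) = n - 1"
  using four_le by simp

lemma not_marked_ear_edge: "\<not> marked_ear x (Suc x)"
  using four_le by (auto simp: marked_ear_def)

lemma finite_dissections: "finite (dissections a b)"
proof -
  have "finite (chords a b)"
    by (rule finite_subset[of _ "{..b} \<times> {..b}"]) (auto simp: chords_def)
  then show ?thesis by (simp add: dissections_def finite_maximal_independent)
qed

lemma dissections_subset: "T \<in> dissections a b \<Longrightarrow> T \<subseteq> chords a b"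
  unfolding dissections_def by (rule maximal_independent_subset)

lemma dissections_noncrossing:
  "T \<in> dissections a b \<Longrightarrow> e \<in> T \<Longrightarrow> f \<in> T \<Longrightarrow> \<not> interleave e f"
  unfolding dissections_def by (rule maximal_independent_independent)

lemma dissections_maximal:
  "T \<in> dissections a b \<Longrightarrow> e \<in> chords a b \<Longrightarrow> (\<And>f. f \<in> T \<Longrightarrow> \<not> interleave e f) \<Longrightarrow> e \<in> T"
  unfolding dissections_def by (rule maximal_independent_maximal)

lemma dissectionsI:
  assumes "T \<subseteq> chords a b" "\<And>e f. e \<in> T \<Longrightarrow> f \<in> T \<Longrightarrow> \<not> interleave e f"
    "\<And>e. e \<in> chords a b \<Longrightarrow> e \<notin> T \<Longrightarrow> \<exists>f\<in>T. interleave e f"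
  shows "T \<in> dissections a b"
  using assms by (auto simp: dissections_def maximal_independent_def)

lemma base_in_dissections:
  assumes "T \<in> dissections a b" "a < b" "\<not> marked_ear a b"
  shows "(a, b) \<in> T"
  by (rule dissections_maximal[OF assms(1)])
    (use assms dissections_subset[OF assms(1)] in \<open>auto simp: chords_def interleave_def\<close>)

lemma edge_in_dissections:
  assumes "T \<in> dissections a b" "a \<le> x" "Suc x \<le> b"
  shows "(x, Suc x) \<in> T"
  by (rule dissections_maximal[OF assms(1)])
    (use assms not_marked_ear_edge in \<open>auto simp: chords_def interleave_def\<close>)

text \<open>Take \<open>c\<close> maximal with \<open>(a, c)\<close> in \<open>T\<close>. If \<open>(c, b)\<close> were a marked ear, then \<open>c + 1\<close> would be
  marked and, having no marked neighbour, could be joined to \<open>a\<close>.\<close>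

lemma dissections_apex:
  assumes T: "T \<in> dissections a b" and ab: "a + 2 \<le> b"
  obtains c where "a < c" "c < b" "(a, c) \<in> T" "(c, b) \<in> T"
proof -
  define c where "c = Max {c. c < b \<and> (a, c) \<in> T}"
  have chord: "a \<le> x \<and> x < y \<and> y \<le> b \<and> \<not> marked_ear x y" if "(x, y) \<in> T" for x y
    using dissections_subset[OF T] that by (auto simp: chords_def)
  have fin: "finite {c. c < b \<and> (a, c) \<in> T}" by simp
  have "Suc a \<in> {c. c < b \<and> (a, c) \<in> T}"
    using edge_in_dissections[OF T, of a] ab by simp
  then have "c \<in> {c. c < b \<and> (a, c) \<in> T}" unfolding c_def using fin Max_in by blast
  then have c: "c < b" "(a, c) \<in> T" "a < c" using chord by auto
  have Max: "y \<le> c" if "y < b" "(a, y) \<in> T" for y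
    unfolding c_def by (rule Max_ge[OF fin]) (simp add: that)
  have not_over_c: "\<not> (a < x \<and> x < c \<and> c < y)" if "(x, y) \<in> T" for x y
    using dissections_noncrossing[OF T c(2) that] by (auto simp: interleave_def)
  have "\<not> marked_ear c b"
  proof
    assume ear: "marked_ear c b"
    then have b: "c + 1 \<in> M" "b = c + 2" using c by (auto simp: marked_ear_def)
    have "\<not> marked_ear a (Suc c)" using b c(3) not_adjacent[of c] not_adjacent[of "Suc c"] Suc_diff_two
      by (auto simp: marked_ear_def)
    then have "(a, Suc c) \<in> chords a b" using c b by (auto simp: chords_def)
    moreover have "\<not> interleave (a, Suc c) (x, y)" if "(x, y) \<in> T" for x y
      using chord[OF that] not_over_c[OF that] b ear
      by (cases "x = c"; cases "y = b") (auto simp: interleave_def)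
    ultimately have "(a, Suc c) \<in> T" using dissections_maximal[OF T] by auto
    with Max[of "Suc c"] b show False by simp
  qed
  then have "(c, b) \<in> chords a b" using c by (simp add: chords_def)
  moreover have "\<not> interleave (c, b) (x, y)" if "(x, y) \<in> T" for x y
    using that chord[OF that] Max[of y] not_over_c[OF that] by (auto simp: interleave_def)
  ultimately have "(c, b) \<in> T" using dissections_maximal[OF T] by auto
  with c that show thesis by blast
qed

lemma dissections_apex_unique:
  assumes "T \<in> dissections a b" "(a, c) \<in> T" "(c, b) \<in> T" "(a, d) \<in> T" "(d, b) \<in> T"
  shows "c = d"
proof -
  have "\<not> interleave (a, c) (d, b)" "\<not> interleave (a, d) (c, b)"
    using assms by (auto dest: dissections_noncrossing)
  moreover have "a < c" "c < b" "a < d" "d < b"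
    using assms dissections_subset[OF assms(1)] by (auto simp: chords_def)
  ultimately show ?thesis by (auto simp: interleave_def)
qed

lemma dissections_Int_chords:
  assumes T: "T \<in> dissections a b" and xy: "(x, y) \<in> T"
  shows "T \<inter> chords x y \<in> dissections x y"
proof (rule dissectionsI)
  fix e assume e: "e \<in> chords x y" "e \<notin> T \<inter> chords x y"
  have "(x, y) \<in> chords a b" using dissections_subset[OF T] xy by blast
  with e have "e \<in> chords a b" "e \<notin> T" by (auto simp: chords_def)
  then obtain f where f: "f \<in> T" "interleave e f" using dissections_maximal[OF T] by blast
  moreover have "\<not> interleave f (x, y)" using dissections_noncrossing[OF T f(1) xy] .
  moreover have "f \<in> chords a b" using dissections_subset[OF T] f by blast
  ultimately have "f \<in> chords x y" using e(1) by (auto simp: chords_def interleave_def)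
  with f show "\<exists>f\<in>T \<inter> chords x y. interleave e f" by blast
qed (use dissections_noncrossing[OF T] in auto)

lemma chords_straddling:
  assumes "e \<in> chords a b" "a < c" "c < b"
  shows "e = (a, b) \<or> e \<in> chords a c \<or> e \<in> chords c b \<or> interleave e (a, c) \<or> interleave e (c, b)"
  using assms by (auto simp: chords_def interleave_def)

lemma dissections_split:
  assumes T: "T \<in> dissections a b" and apex: "(a, c) \<in> T" "(c, b) \<in> T" and base: "\<not> marked_ear a b"
  shows "insert (a, b) (T \<inter> chords a c \<union> T \<inter> chords c b) = T"
proof -
  have c: "a < c" "c < b" using apex dissections_subset[OF T] by (auto simp: chords_def)
  have "e = (a, b) \<or> e \<in> chords a c \<or> e \<in> chords c b" if "e \<in> T" for e
    using chords_straddling[OF _ c] dissections_subset[OF T] dissections_noncrossing[OF T that]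
      apex that by blast
  moreover have "(a, b) \<in> T" using base_in_dissections[OF T _ base] c by simp
  ultimately show ?thesis by blast
qed

lemma dissections_join:
  assumes T: "T \<in> dissections a c" "T' \<in> dissections c b"
    and c: "a < c" "c < b" "\<not> marked_ear a c" "\<not> marked_ear c b" and base: "\<not> marked_ear a b"
  shows "insert (a, b) (T \<union> T') \<in> dissections a b"
proof (rule dissectionsI)
  have sub: "T \<subseteq> chords a c" "T' \<subseteq> chords c b" using T by (auto dest: dissections_subset)
  have sides: "(a, c) \<in> T" "(c, b) \<in> T'" using T c by (auto intro: base_in_dissections)
  show join_sub: "insert (a, b) (T \<union> T') \<subseteq> chords a b"
    using sub c base by (auto simp: chords_def)
  fix e
  {
    fix f assume ef: "e \<in> insert (a, b) (T \<union> T')" "f \<in> insert (a, b) (T \<union> T')"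
    consider "e \<in> T" "f \<in> T" | "e \<in> T'" "f \<in> T'" | (base) "e = (a, b) \<or> f = (a, b)"
      | "e \<in> chords a c" "f \<in> chords c b" | "e \<in> chords c b" "f \<in> chords a c"
      using ef sub by blast
    then show "\<not> interleave e f"
    proof cases
      case base
      then show ?thesis using ef join_sub by (auto simp: chords_def interleave_def)
    qed (use T[THEN dissections_noncrossing] in \<open>auto simp: chords_def interleave_def\<close>)
  }
  assume "e \<in> chords a b" "e \<notin> insert (a, b) (T \<union> T')"
  then consider "e \<in> chords a c" "e \<notin> T" | "e \<in> chords c b" "e \<notin> T'"
    | "interleave e (a, c) \<or> interleave e (c, b)"
    using chords_straddling[of e a b c] c by blast
  then show "\<exists>f\<in>insert (a, b) (T \<union> T'). interleave e f"
    using T[THEN dissections_maximal, of e] sides by cases blast+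
qed

lemma bij_betw_dissections_join:
  assumes c: "a < c" "c < b" "\<not> marked_ear a c" "\<not> marked_ear c b" and base: "\<not> marked_ear a b"
  shows "bij_betw (\<lambda>(T, T'). insert (a, b) (T \<union> T')) (dissections a c \<times> dissections c b)
    {T \<in> dissections a b. (a, c) \<in> T \<and> (c, b) \<in> T}"
proof (rule bij_betwI[where g = "\<lambda>T. (T \<inter> chords a c, T \<inter> chords c b)"])
  show "(\<lambda>(T, T'). insert (a, b) (T \<union> T')) \<in>
      dissections a c \<times> dissections c b \<rightarrow> {T \<in> dissections a b. (a, c) \<in> T \<and> (c, b) \<in> T}"
    using dissections_join[OF _ _ c base] base_in_dissections[of _ a c] base_in_dissections[of _ c b] c
    by auto
  show "(\<lambda>T. (T \<inter> chords a c, T \<inter> chords c b)) \<in>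
      {T \<in> dissections a b. (a, c) \<in> T \<and> (c, b) \<in> T} \<rightarrow> dissections a c \<times> dissections c b"
    by (auto elim: dissections_Int_chords)
next
  fix P assume "P \<in> dissections a c \<times> dissections c b"
  then obtain T T' where P: "P = (T, T')" and "T \<in> dissections a c" "T' \<in> dissections c b"
    by auto
  then have "T \<subseteq> chords a c" "T' \<subseteq> chords c b"
    by (auto dest: dissections_subset)
  then have "insert (a, b) (T \<union> T') \<inter> chords a c = T" "insert (a, b) (T \<union> T') \<inter> chords c b = T'"
    using c by (auto simp: chords_def)
  then show "((case P of (T, T') \<Rightarrow> insert (a, b) (T \<union> T')) \<inter> chords a c,
      (case P of (T, T') \<Rightarrow> insert (a, b) (T \<union> T')) \<inter> chords c b) = P"
    by (simp add: P)
next
  fix T assume "T \<in> {T \<in> dissections a b. (a, c) \<in> T \<and> (c, b) \<in> T}"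
  then show "(case (T \<inter> chords a c, T \<inter> chords c b) of (T, T') \<Rightarrow> insert (a, b) (T \<union> T')) = T"
    using dissections_split[OF _ _ _ base] by simp
qed

definition dissection_count :: "nat \<Rightarrow> nat \<Rightarrow> nat" where
  "dissection_count a b = (if marked_ear a b then 0 else card (dissections a b))"

lemma dissection_count_edge: "dissection_count a (Suc a) = 1"
proof -
  have "chords a (Suc a) = {(a, Suc a)}"
    using not_marked_ear_edge by (auto simp: chords_def le_Suc_eq)
  then have "dissections a (Suc a) = {{(a, Suc a)}}"
    by (auto simp: dissections_def maximal_independent_def interleave_def)
  then show ?thesis by (simp add: dissection_count_def not_marked_ear_edge)
qed

lemma card_dissections_with_apex:
  assumes "a < c" "c < b" "\<not> marked_ear a b"
  shows "card {T \<in> dissections a b. (a, c) \<in> T \<and> (c, b) \<in> T} =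
    dissection_count a c * dissection_count c b"
proof (cases "marked_ear a c \<or> marked_ear c b")
  case True
  then have "\<not> ((a, c) \<in> T \<and> (c, b) \<in> T)" if "T \<in> dissections a b" for T
    using dissections_subset[OF that] by (auto simp: chords_def)
  then have "{T \<in> dissections a b. (a, c) \<in> T \<and> (c, b) \<in> T} = {}" by blast
  moreover have "dissection_count a c * dissection_count c b = 0"
    using True by (auto simp: dissection_count_def)
  ultimately show ?thesis by (simp only: card.empty)
next
  case False
  then have "card (dissections a c \<times> dissections c b) =
      card {T \<in> dissections a b. (a, c) \<in> T \<and> (c, b) \<in> T}"
    using assms by (intro bij_betw_same_card[OF bij_betw_dissections_join]) auto
  with False show ?thesis by (simp add: dissection_count_def card_cartesian_product)
qed

lemma dissection_count_rec:
  assumes ab: "a + 2 \<le> b" and base: "\<not> marked_ear a b"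
  shows "dissection_count a b = (\<Sum>c\<in>{a<..<b}. dissection_count a c * dissection_count c b)"
proof -
  define D where "D c = {T \<in> dissections a b. (a, c) \<in> T \<and> (c, b) \<in> T}" for c
  have "T \<in> (\<Union>c\<in>{a<..<b}. D c)" if T: "T \<in> dissections a b" for T
    by (rule dissections_apex[OF T ab]) (use T in \<open>auto simp: D_def\<close>)
  then have "dissections a b = (\<Union>c\<in>{a<..<b}. D c)" by (auto simp: D_def)
  also have "card \<dots> = (\<Sum>c\<in>{a<..<b}. card (D c))"
  proof (rule card_UN_disjoint)
    show "\<forall>c\<in>{a<..<b}. finite (D c)" by (simp add: D_def finite_dissections)
    show "\<forall>c\<in>{a<..<b}. \<forall>d\<in>{a<..<b}. c \<noteq> d \<longrightarrow> D c \<inter> D d = {}"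
      unfolding D_def using dissections_apex_unique by blast
  qed simp
  also have "\<dots> = (\<Sum>c\<in>{a<..<b}. dissection_count a c * dissection_count c b)"
    using base by (intro sum.cong) (auto simp: D_def card_dissections_with_apex)
  finally show ?thesis using base by (simp add: dissection_count_def)
qed

definition interval_count :: "nat \<Rightarrow> nat \<Rightarrow> int" where
  "interval_count a b = ear_free_count (card {a<..<b}) (M \<inter> {a<..<b})"

lemma interval_count_edge: "interval_count a (Suc a) = 1"
proof -
  have "{a<..<Suc a} = {}" by auto
  then show ?thesis by (simp add: interval_count_def ear_free_count_empty)
qed

lemma interval_count_ear:
  assumes "a + 1 \<in> M"
  shows "interval_count a (a + 2) = 0"
proof -
  have "{a<..<a + 2} = {a + 1}" by auto
  then show ?thesis
    using assms by (simp add: interval_count_def ear_free_count_insert ear_free_count_empty)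
qed

lemma interval_count_rec:
  assumes "a + 2 \<le> b" "\<not> (b = a + 2 \<and> a + 1 \<in> M)"
  shows "(\<Sum>c\<in>{a<..<b}. interval_count a c * interval_count c b) = interval_count a b"
proof -
  have "a + 1 \<notin> M \<or> a + 2 \<in> {a<..<b} - M"
    using assms not_adjacent[of "a + 1"] by auto
  then have "M \<inter> {a<..<b} \<subset> {a<..<b}" using assms by force
  moreover have "{x \<in> {a<..<b}. x < c} = {a<..<c}" "{x \<in> {a<..<b}. c < x} = {c<..<b}"
    "{x \<in> M \<inter> {a<..<b}. x < c} = M \<inter> {a<..<c}" "{x \<in> M \<inter> {a<..<b}. c < x} = M \<inter> {c<..<b}"
    if "c \<in> {a<..<b}" for c
    using that by auto
  ultimately show ?thesis
    using ear_free_count_convolution[of "{a<..<b}" "M \<inter> {a<..<b}"]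
    by (simp add: interval_count_def)
qed

text \<open>The last assumption excludes the intervals that contain the ear \<open>(0, n - 2)\<close> at \<open>n - 1\<close>.\<close>

lemma dissection_count_eq_interval_count:
  assumes "a < b" "b < n" "n - 1 \<in> M \<Longrightarrow> 0 < a \<or> b < n - 2"
  shows "int (dissection_count a b) = interval_count a b"
  using assms
proof (induction "b - a" arbitrary: a b rule: less_induct)
  case less
  consider (edge) "b = Suc a" | (ear) "marked_ear a b" | (apex) "a + 2 \<le> b" "\<not> marked_ear a b"
    using less.prems by linarith
  then show ?case
  proof cases
    case edge
    then show ?thesis by (simp add: dissection_count_edge interval_count_edge)
  next
    case ear
    then show ?thesis using less.prems interval_count_ear[of a]
      by (auto simp: dissection_count_def marked_ear_def)
  next
    case apex
    have "int (dissection_count a b) =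
        (\<Sum>c\<in>{a<..<b}. int (dissection_count a c) * int (dissection_count c b))"
      using dissection_count_rec[OF apex] by simp
    also have "\<dots> = (\<Sum>c\<in>{a<..<b}. interval_count a c * interval_count c b)"
    proof (rule sum.cong)
      fix c assume "c \<in> {a<..<b}"
      then have "int (dissection_count a c) = interval_count a c"
        "int (dissection_count c b) = interval_count c b"
        using less.prems by (intro less.hyps; force)+
      then show "int (dissection_count a c) * int (dissection_count c b) =
          interval_count a c * interval_count c b" by simp
    qed simp
    also have "\<dots> = interval_count a b"
      using apex by (intro interval_count_rec) (auto simp: marked_ear_def)
    finally show ?thesis .
  qed
qed

lemma not_marked_ear_base: "\<not> marked_ear 0 (n - 1)"
  using four_le not_adjacent[of 1] by (auto simp: marked_ear_def)

lemma dissection_count_last_marked: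
  assumes last: "n - 1 \<in> M"
  shows "int (dissection_count 0 (n - 1)) = interval_count 0 (n - 1) - interval_count 0 (n - 2)"
proof -
  have interior: "{0<..<n - 1} = insert (n - 2) {0<..<n - 2}" using four_le by auto
  have "int (dissection_count 0 (n - 1)) =
      (\<Sum>c\<in>{0<..<n - 1}. int (dissection_count 0 c) * int (dissection_count c (n - 1)))"
    using dissection_count_rec[OF _ not_marked_ear_base] four_le by simp
  also have "\<dots> = (\<Sum>c\<in>{0<..<n - 2}. int (dissection_count 0 c) * int (dissection_count c (n - 1)))"
    unfolding interior using last by (simp add: dissection_count_def marked_ear_def)
  also have "\<dots> = (\<Sum>c\<in>{0<..<n - 2}. interval_count 0 c * interval_count c (n - 1))"
    by (intro sum.cong refl) (auto simp: dissection_count_eq_interval_count)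
  also have "\<dots> = (\<Sum>c\<in>{0<..<n - 1}. interval_count 0 c * interval_count c (n - 1)) -
      interval_count 0 (n - 2) * interval_count (n - 2) (n - 1)"
    unfolding interior by simp
  also have "interval_count (n - 2) (n - 1) = 1"
    using interval_count_edge[of "n - 2"] by (simp add: Suc_diff_two)
  also have "(\<Sum>c\<in>{0<..<n - 1}. interval_count 0 c * interval_count c (n - 1)) =
      interval_count 0 (n - 1)"
    using four_le by (intro interval_count_rec) auto
  finally show ?thesis by simp
qed

theorem card_dissections: "int (card (dissections 0 (n - 1))) = ear_free_count (n - 2) M"
proof -
  have card_interior: "card {0<..<n - 1} = n - 2" "card {0<..<n - 2} = n - 2 - 1" by auto
  have "int (dissection_count 0 (n - 1)) = ear_free_count (n - 2) M"
  proof (cases "n - 1 \<in> M")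
    case False
    have "x < n - 1" if "x \<in> M" for x
    proof -
      have "x < n" "x \<noteq> n - 1" using that marked_subset False by auto
      then show ?thesis by linarith
    qed
    then have "M \<inter> {0<..<n - 1} = M" using marked_subset by auto
    then show ?thesis
      using dissection_count_eq_interval_count[of 0 "n - 1"] False four_le card_interior
      by (simp add: interval_count_def)
  next
    case True
    define N where "N = M - {n - 1}"
    have "n - 2 \<notin> M" using not_adjacent[of "n - 2"] True by (auto simp: Suc_diff_two)
    have "x < n - 2" if "x \<in> N" for x
    proof -
      have "x < n" "x \<noteq> n - 1" "x \<noteq> n - 2"
        using that marked_subset \<open>n - 2 \<notin> M\<close> by (auto simp: N_def)
      then show ?thesis by linarith
    qed
    then have "M \<inter> {0<..<n - 1} = N" "M \<inter> {0<..<n - 2} = N"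
      using marked_subset by (force simp: N_def)+
    then have "int (dissection_count 0 (n - 1)) =
        ear_free_count (n - 2) N - ear_free_count (n - 2 - 1) N"
      using dissection_count_last_marked[OF True] card_interior by (simp only: interval_count_def)
    also have "\<dots> = ear_free_count (n - 2) (insert (n - 1) N)"
      using marked_subset by (subst ear_free_count_insert) (auto simp: N_def intro: finite_subset)
    also have "insert (n - 1) N = M" using True by (auto simp: N_def)
    finally show ?thesis .
  qed
  then show ?thesis using not_marked_ear_base by (simp add: dissection_count_def)
qed

end

subsection \<open>Triangulations of a dented polygon\<close>

definition orient :: "point \<Rightarrow> point \<Rightarrow> point \<Rightarrow> real" where
  "orient p q r = (fst q - fst p) * (snd r - snd p) - (snd q - snd p) * (fst r - fst p)"

lemma orient_rotate: "orient p q r = orient q r p"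
  by (simp add: orient_def algebra_simps)

lemma orient_swap: "orient p q r = - orient q p r"
  by (simp add: orient_def algebra_simps)

lemma orient_degenerate [simp]: "orient p p r = 0" "orient p q p = 0" "orient p q q = 0"
  by (simp_all add: orient_def algebra_simps)

lemma orient_affine:
  "orient p q ((1 - u) *\<^sub>R r + u *\<^sub>R s) = (1 - u) * orient p q r + u * orient p q s"
  by (simp add: orient_def algebra_simps)

lemma orient_quadrilateral: "orient p q r + orient p r s = orient p q s + orient q r s"
  by (simp add: orient_def algebra_simps)

lemma closed_segments_disjoint_if_same_side:
  assumes "orient A B C * orient A B D > 0"
  shows "closed_segment A B \<inter> closed_segment C D = {}"
proof (rule ccontr)
  assume "\<not> ?thesis"
  then obtain u v where u: "0 \<le> u" "u \<le> 1" and
      eq: "(1 - v) *\<^sub>R A + v *\<^sub>R B = (1 - u) *\<^sub>R C + u *\<^sub>R D"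
    unfolding closed_segment_def by blast
  have "(1 - u) * orient A B C + u * orient A B D = orient A B ((1 - v) *\<^sub>R A + v *\<^sub>R B)"
    unfolding eq by (simp only: orient_affine)
  also have "\<dots> = 0" by (simp add: orient_affine)
  finally have "orient A B C * ((1 - u) * orient A B C + u * orient A B D) = 0" by simp
  then have "(1 - u) * (orient A B C)\<^sup>2 + u * (orient A B C * orient A B D) = 0"
    by (simp add: algebra_simps power2_eq_square)
  moreover have "(orient A B C)\<^sup>2 > 0" using assms by auto
  then have "(1 - u) * (orient A B C)\<^sup>2 + u * (orient A B C * orient A B D) > 0"
    using u assms by (cases "u = 0") (auto intro: add_nonneg_pos)
  ultimately show False by simp
qed

text \<open>The segments meet at \<open>A + s (B - A) = C + t (D - C)\<close>, with \<open>s\<close> and \<open>t\<close> given by Cramer's rule.\<close>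

lemma closed_segments_meet_if_opposite_sides:
  assumes "orient A B C * orient A B D < 0" "orient C D A * orient C D B < 0"
  shows "closed_segment A B \<inter> closed_segment C D \<noteq> {}"
proof -
  define \<delta> where "\<delta> = orient A B C - orient A B D"
  define s where "s = orient C D A / (orient C D A - orient C D B)"
  define t where "t = orient A B C / \<delta>"
  have unit: "0 \<le> x / (x - y) \<and> x / (x - y) \<le> 1 \<and> x - y \<noteq> 0" if "x * y < 0" for x y :: real
    using that by (auto simp: mult_less_0_iff field_simps)
  have st: "0 \<le> s" "s \<le> 1" "0 \<le> t" "t \<le> 1" and nz: "\<delta> \<noteq> 0"
    using unit assms unfolding s_def t_def \<delta>_def by blast+
  have "orient C D A - orient C D B = - \<delta>"
    by (simp add: \<delta>_def orient_def algebra_simps)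
  then have coeffs: "orient A B C = \<delta> * t" "orient C D A = - (\<delta> * s)"
    using nz by (simp_all add: s_def t_def)
  have "orient A B C *\<^sub>R (D - C) = \<delta> *\<^sub>R (A - C) - orient C D A *\<^sub>R (B - A)"
    by (simp add: \<delta>_def orient_def prod_eq_iff algebra_simps)
  then have "\<delta> *\<^sub>R (t *\<^sub>R (D - C)) = \<delta> *\<^sub>R (A - C + s *\<^sub>R (B - A))"
    unfolding coeffs by (simp add: scaleR_right_distrib)
  then have "t *\<^sub>R (D - C) = A - C + s *\<^sub>R (B - A)"
    using nz by (simp only: scaleR_cancel_left) simp
  then have "(1 - t) *\<^sub>R C + t *\<^sub>R D = (1 - s) *\<^sub>R A + s *\<^sub>R B"
    by (simp add: algebra_simps)
  with st show ?thesis unfolding closed_segment_def by blast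
qed

lemma closed_segments_meet_iff:
  assumes "orient A B C \<noteq> 0" "orient A B D \<noteq> 0" "orient C D A \<noteq> 0" "orient C D B \<noteq> 0"
  shows "closed_segment A B \<inter> closed_segment C D \<noteq> {} \<longleftrightarrow>
    orient A B C * orient A B D < 0 \<and> orient C D A * orient C D B < 0"
proof -
  have "orient A B C * orient A B D \<noteq> 0" "orient C D A * orient C D B \<noteq> 0"
    using assms by simp_all
  then consider (opposite) "orient A B C * orient A B D < 0" "orient C D A * orient C D B < 0"
    | (same_side_of_AB) "orient A B C * orient A B D > 0"
    | (same_side_of_CD) "orient C D A * orient C D B > 0"
    by linarith
  then show ?thesis
  proof cases
    case opposite
    then show ?thesis using closed_segments_meet_if_opposite_sides by blast
  next
    case same_side_of_AB
    then show ?thesis using closed_segments_disjoint_if_same_side[of A B C D] by simp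
  next
    case same_side_of_CD
    then show ?thesis using closed_segments_disjoint_if_same_side[of C D A B] by (simp add: Int_commute)
  qed
qed

lemma crosses_commute: "crosses e f \<longleftrightarrow> crosses f e"
  by (auto simp: crosses_def)

lemma bij_betw_segments:
  fixes v :: "nat \<Rightarrow> point"
  assumes inj: "inj_on v {..<n}"
  shows "bij_betw (\<lambda>(a, b). {v a, v b}) {(a, b). a < b \<and> b < n} (segments (v ` {..<n}))"
proof (rule bij_betw_imageI)
  have eq_iff: "v a = v b \<longleftrightarrow> a = b" if "a < n" "b < n" for a b
    using inj that by (auto dest: inj_onD)
  show "inj_on (\<lambda>(a, b). {v a, v b}) {(a, b). a < b \<and> b < n}"
    by (auto simp: inj_on_def doubleton_eq_iff eq_iff)
  show "(\<lambda>(a, b). {v a, v b}) ` {(a, b). a < b \<and> b < n} = segments (v ` {..<n})"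
  proof (intro equalityI subsetI)
    fix s assume "s \<in> segments (v ` {..<n})"
    then obtain a b where "s = {v a, v b}" "a < n" "b < n" "v a \<noteq> v b"
      unfolding segments_def by blast
    then have "s = {v (min a b), v (max a b)}" "min a b < max a b" "max a b < n"
      by (auto simp: min_def max_def order.strict_iff_order)
    then show "s \<in> (\<lambda>(a, b). {v a, v b}) ` {(a, b). a < b \<and> b < n}"
      by (intro image_eqI[of _ _ "(min a b, max a b)"]) simp_all
  next
    fix s assume "s \<in> (\<lambda>(a, b). {v a, v b}) ` {(a, b). a < b \<and> b < n}"
    then obtain a b where "s = {v a, v b}" "a < b" "b < n" by auto
    moreover have "v a \<in> v ` {..<n}" "v b \<in> v ` {..<n}" "v a \<noteq> v b"
      using \<open>a < b\<close> \<open>b < n\<close> by (auto simp: eq_iff)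
    ultimately show "s \<in> segments (v ` {..<n})"
      unfolding segments_def by blast
  qed
qed

definition dent :: "nat \<Rightarrow> nat set \<Rightarrow> nat \<Rightarrow> nat \<Rightarrow> nat \<Rightarrow> bool" where
  "dent n M a b c \<longleftrightarrow> b = a + 1 \<and> c = a + 2 \<and> b \<in> M \<or> a = 0 \<and> b = n - 2 \<and> c = n - 1 \<and> c \<in> M"

locale dented_polygon = marked_polygon +
  fixes v :: "nat \<Rightarrow> point"
  assumes orient_dent: "a < b \<Longrightarrow> b < c \<Longrightarrow> c < n \<Longrightarrow> dent n M a b c \<Longrightarrow> orient (v a) (v b) (v c) < 0"
    and orient_not_dent: "a < b \<Longrightarrow> b < c \<Longrightarrow> c < n \<Longrightarrow> \<not> dent n M a b c \<Longrightarrow> orient (v a) (v b) (v c) > 0"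
begin

lemma orient_pos_iff: "a < b \<Longrightarrow> b < c \<Longrightarrow> c < n \<Longrightarrow> orient (v a) (v b) (v c) > 0 \<longleftrightarrow> \<not> dent n M a b c"
  using orient_dent[of a b c] orient_not_dent[of a b c] by fastforce

lemma orient_nonzero_less: "a < b \<Longrightarrow> b < c \<Longrightarrow> c < n \<Longrightarrow> orient (v a) (v b) (v c) \<noteq> 0"
  using orient_dent[of a b c] orient_not_dent[of a b c] by fastforce

lemma orient_nonzero:
  assumes "distinct [a, b, c]" "a < n" "b < n" "c < n"
  shows "orient (v a) (v b) (v c) \<noteq> 0"
proof -
  have even_permutation: "orient (v x) (v y) (v z) \<noteq> 0"
    if "x < y \<and> y < z \<or> y < z \<and> z < x \<or> z < x \<and> x < y" "x < n" "y < n" "z < n" for x y z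
    using that orient_nonzero_less[of x y z] orient_nonzero_less[of y z x] orient_nonzero_less[of z x y]
      orient_rotate[of "v x" "v y" "v z"] orient_rotate[of "v z" "v x" "v y"] by auto
  have "a < b \<and> b < c \<or> b < c \<and> c < a \<or> c < a \<and> a < b \<or>
      b < a \<and> a < c \<or> a < c \<and> c < b \<or> c < b \<and> b < a"
    using assms(1) by auto
  then show ?thesis
    using even_permutation[of a b c] even_permutation[of b a c] assms
      orient_swap[of "v a" "v b" "v c"] by auto
qed

lemma inj_on_vertices: "inj_on v {..<n}"
proof -
  have "v a \<noteq> v b" if "a < b" "b < n" for a b
  proof -
    consider "0 < a" | "a + 1 < b" | "b + 1 < n" using \<open>a < b\<close> four_le by linarith
    then show ?thesis
      using orient_nonzero_less[of 0 a b] orient_nonzero_less[of a "a + 1" b]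
        orient_nonzero_less[of a b "b + 1"] that
      by cases auto
  qed
  then show ?thesis by (auto simp: inj_on_def) (metis linorder_neqE_nat)
qed

lemma vertex_eq_iff: "a < n \<Longrightarrow> b < n \<Longrightarrow> v a = v b \<longleftrightarrow> a = b"
  using inj_on_vertices by (auto dest: inj_onD)

lemma marked_ear_iff_dent:
  assumes "a < b" "b < c" "c < d" "d < n"
  shows "marked_ear a c \<longleftrightarrow> dent n M a b c \<or> dent n M a c d"
    "marked_ear b d \<longleftrightarrow> dent n M b c d" "\<not> dent n M a b d"
proof -
  have "c = a + 2 \<Longrightarrow> b = a + 1" "c = n - 2 \<Longrightarrow> d = n - 1" "d = b + 2 \<Longrightarrow> c = b + 1"
    "b \<noteq> 0" "b \<noteq> n - 2" "c \<noteq> n - 1" "c \<noteq> a + 1" "d \<noteq> a + 2"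
    using assms by linarith+
  then show "marked_ear a c \<longleftrightarrow> dent n M a b c \<or> dent n M a c d"
    "marked_ear b d \<longleftrightarrow> dent n M b c d" "\<not> dent n M a b d"
    unfolding marked_ear_def dent_def by metis+
qed

text \<open>At most one of the four triples is a dent.  Two of them would be dents at adjacent vertices, except
  for \<open>(a, b, c)\<close> and \<open>(a, c, d)\<close>, which are excluded together by the additivity of the signed area.\<close>

lemma orient_quadruple:
  assumes "a < b" "b < c" "c < d" "d < n"
  shows "orient (v a) (v b) (v d) > 0"
    and "orient (v a) (v b) (v c) < 0 \<Longrightarrow> orient (v a) (v c) (v d) > 0"
    and "orient (v a) (v b) (v c) < 0 \<Longrightarrow> orient (v b) (v c) (v d) > 0"
    and "orient (v a) (v c) (v d) < 0 \<Longrightarrow> orient (v b) (v c) (v d) > 0"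
proof -
  show abd: "orient (v a) (v b) (v d) > 0"
    using assms marked_ear_iff_dent(3)[OF assms] by (simp add: orient_pos_iff)
  show bcd: "orient (v b) (v c) (v d) > 0" if "orient (v a) (v b) (v c) < 0"
  proof (rule orient_not_dent)
    have "dent n M a b c" using orient_not_dent[of a b c] that assms by force
    then show "\<not> dent n M b c d" using assms not_adjacent by (auto simp: dent_def)
  qed (use assms in auto)
  show "orient (v b) (v c) (v d) > 0" if "orient (v a) (v c) (v d) < 0"
  proof (rule orient_not_dent)
    have "dent n M a c d" using orient_not_dent[of a c d] that assms by force
    then have "d \<in> M" using assms by (auto simp: dent_def)
    moreover have "c \<in> M \<and> d = Suc c" if "dent n M b c d" using that assms by (auto simp: dent_def)
    ultimately show "\<not> dent n M b c d" using not_adjacent by blast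
  qed (use assms in auto)
  show "orient (v a) (v c) (v d) > 0" if "orient (v a) (v b) (v c) < 0"
    using orient_quadrilateral[of "v a" "v b" "v c" "v d"] abd bcd[OF that] that by linarith
qed

lemma crosses_iff_orient:
  assumes "distinct [a, b, c, d]" "a < n" "b < n" "c < n" "d < n"
  shows "crosses {v a, v b} {v c, v d} \<longleftrightarrow>
    orient (v a) (v b) (v c) * orient (v a) (v b) (v d) < 0 \<and>
    orient (v c) (v d) (v a) * orient (v c) (v d) (v b) < 0"
proof -
  have "crosses {v a, v b} {v c, v d} \<longleftrightarrow> closed_segment (v a) (v b) \<inter> closed_segment (v c) (v d) \<noteq> {}"
    using assms by (auto simp: crosses_def segment_convex_hull vertex_eq_iff)
  also have "\<dots> \<longleftrightarrow> orient (v a) (v b) (v c) * orient (v a) (v b) (v d) < 0 \<and>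
      orient (v c) (v d) (v a) * orient (v c) (v d) (v b) < 0"
    using assms by (intro closed_segments_meet_iff orient_nonzero) auto
  finally show ?thesis .
qed

lemma crosses_quadruple:
  assumes "a < b" "b < c" "c < d" "d < n"
  shows "\<not> crosses {v a, v b} {v c, v d}" "\<not> crosses {v a, v d} {v b, v c}"
    "crosses {v a, v c} {v b, v d} \<longleftrightarrow> \<not> marked_ear a c \<and> \<not> marked_ear b d"
proof -
  let ?o = "\<lambda>a b c. orient (v a) (v b) (v c)"
  have sorted: "?o c d a = ?o a c d" "?o c d b = ?o b c d" "?o b d a = ?o a b d" "?o b d c = - ?o b c d"
    "?o b c a = ?o a b c" "?o a c b = - ?o a b c" "?o a d b = - ?o a b d" "?o a d c = - ?o a c d"
    by (simp_all add: orient_def algebra_simps)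
  note sign = orient_quadruple[OF assms]
  have crosses_iff:
    "crosses {v a, v b} {v c, v d} \<longleftrightarrow> ?o a b c * ?o a b d < 0 \<and> ?o a c d * ?o b c d < 0"
    "crosses {v a, v d} {v b, v c} \<longleftrightarrow> ?o a b d * ?o a c d < 0 \<and> ?o a b c * ?o b c d < 0"
    "crosses {v a, v c} {v b, v d} \<longleftrightarrow> ?o a b c * ?o a c d > 0 \<and> ?o a b d * ?o b c d > 0"
    using assms by (simp_all add: crosses_iff_orient sorted)
  show "\<not> crosses {v a, v b} {v c, v d}" "\<not> crosses {v a, v d} {v b, v c}"
    unfolding crosses_iff mult_less_0_iff using sign by linarith+
  have "crosses {v a, v c} {v b, v d} \<longleftrightarrow> ?o a b c > 0 \<and> ?o a c d > 0 \<and> ?o b c d > 0"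
    unfolding crosses_iff zero_less_mult_iff using sign by linarith
  also have "\<dots> \<longleftrightarrow> \<not> dent n M a b c \<and> \<not> dent n M a c d \<and> \<not> dent n M b c d"
    using assms by (simp add: orient_pos_iff)
  also have "\<dots> \<longleftrightarrow> \<not> marked_ear a c \<and> \<not> marked_ear b d"
    using marked_ear_iff_dent[OF assms] by blast
  finally show "crosses {v a, v c} {v b, v d} \<longleftrightarrow> \<not> marked_ear a c \<and> \<not> marked_ear b d" .
qed

lemma crosses_iff_interleave_less:
  assumes "a < b" "b < n" "c < d" "d < n" "a < c" "b \<noteq> c" "b \<noteq> d"
  shows "crosses {v a, v b} {v c, v d} \<longleftrightarrow> interleave (a, b) (c, d) \<and> \<not> marked_ear a b \<and> \<not> marked_ear c d"
proof -
  consider (separated) "b < c" | (crossing) "c < b" "b < d" | (nested) "d < b"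
    using assms by linarith
  then show ?thesis
  proof cases
    case separated
    then show ?thesis using assms crosses_quadruple(1)[of a b c d] by (simp add: interleave_def)
  next
    case crossing
    then show ?thesis using assms crosses_quadruple(3)[of a c b d] by (simp add: interleave_def)
  next
    case nested
    then show ?thesis using assms crosses_quadruple(2)[of a c d b] by (simp add: interleave_def)
  qed
qed

lemma crosses_iff_interleave:
  assumes "a < b" "b < n" "c < d" "d < n"
  shows "crosses {v a, v b} {v c, v d} \<longleftrightarrow> interleave (a, b) (c, d) \<and> \<not> marked_ear a b \<and> \<not> marked_ear c d"
proof -
  consider (common) "a = c \<or> a = d \<or> b = c \<or> b = d"
    | (less) "a < c" "b \<noteq> c" "b \<noteq> d" | (greater) "c < a" "d \<noteq> a" "d \<noteq> b"
    by linarith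
  then show ?thesis
  proof cases
    case common
    then show ?thesis using assms by (auto simp: crosses_def interleave_def)
  next
    case less
    then show ?thesis using assms by (intro crosses_iff_interleave_less)
  next
    case greater
    then show ?thesis
      using crosses_iff_interleave_less[of c d a b] assms crosses_commute interleave_commute by blast
  qed
qed

theorem card_triangulations: "int (card (triangulations (v ` {..<n}))) = ear_free_count (n - 2) M"
proof -
  note segments_bij = bij_betw_segments[OF inj_on_vertices]
  let ?E = "\<lambda>(a, b). {v a, v b}" and ?U = "{(a, b). a < b \<and> b < n}"
  let ?C = "chords 0 (n - 1)"
  have C: "?C \<subseteq> ?U" "?U - ?C = {(a, b) \<in> ?U. marked_ear a b}"
    using four_le by (auto simp: chords_def)
  have crosses: "crosses (?E e) (?E f) \<longleftrightarrow> interleave e f \<and> e \<in> ?C \<and> f \<in> ?C" if "e \<in> ?U" "f \<in> ?U" for e f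
    using that crosses_iff_interleave four_le by (auto simp: chords_def)
  have bij: "bij_betw ?E ?C (segments (v ` {..<n}) - ?E ` (?U - ?C))"
  proof (rule bij_betw_subset[OF segments_bij C(1)])
    have "?E ` ?C = ?E ` (?U - (?U - ?C))" using C(1) by (simp add: double_diff)
    also have "\<dots> = ?E ` ?U - ?E ` (?U - ?C)"
      by (rule inj_on_image_set_diff[OF bij_betw_imp_inj_on[OF segments_bij]]) auto
    finally show "?E ` ?C = segments (v ` {..<n}) - ?E ` (?U - ?C)"
      using bij_betw_imp_surj_on[OF segments_bij] by simp
  qed
  have "card (triangulations (v ` {..<n})) =
      card (maximal_independent (segments (v ` {..<n}) - ?E ` (?U - ?C)) crosses)"
    unfolding triangulations_eq_maximal_independent
  proof (rule card_maximal_independent_Diff_isolated[OF _ crosses_commute])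
    have "segments (v ` {..<n}) = ?E ` ?U" using segments_bij by (simp add: bij_betw_def)
    then show "?E ` (?U - ?C) \<subseteq> segments (v ` {..<n})" by blast
    fix e f assume "e \<in> ?E ` (?U - ?C)" "f \<in> segments (v ` {..<n})"
    then obtain e' f' where "e = ?E e'" "e' \<in> ?U" "e' \<notin> ?C" "f = ?E f'" "f' \<in> ?U"
      unfolding \<open>segments (v ` {..<n}) = ?E ` ?U\<close> by blast
    then show "\<not> crosses e f" using crosses[of e' f'] by blast
  qed
  also have "\<dots> = card (maximal_independent ?C interleave)"
  proof (rule card_maximal_independent_bij_betw[OF bij])
    fix e f assume ef: "e \<in> ?C" "f \<in> ?C"
    with C(1) have "e \<in> ?U" "f \<in> ?U" by blast+
    with ef show "crosses (?E e) (?E f) \<longleftrightarrow> interleave e f" using crosses[of e f] by blast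
  qed
  finally show ?thesis using card_dissections by (simp add: dissections_def)
qed

end

subsection \<open>The double circle\<close>

lemma orient_midpoints_pos:
  assumes nonneg: "\<And>p q r. p \<in> {p1, p2} \<Longrightarrow> q \<in> {q1, q2} \<Longrightarrow> r \<in> {r1, r2} \<Longrightarrow> orient p q r \<ge> 0"
    and "p \<in> {p1, p2}" "q \<in> {q1, q2}" "r \<in> {r1, r2}" and pos: "orient p q r > 0"
  shows "orient (midpoint p1 p2) (midpoint q1 q2) (midpoint r1 r2) > 0"
proof -
  have "orient (midpoint p1 p2) (midpoint q1 q2) (midpoint r1 r2) =
      (orient p1 q1 r1 + orient p1 q1 r2 + orient p1 q2 r1 + orient p1 q2 r2 +
       orient p2 q1 r1 + orient p2 q1 r2 + orient p2 q2 r1 + orient p2 q2 r2) / 8"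
    by (simp add: orient_def midpoint_def field_simps)
  moreover have "orient p1 q1 r1 \<ge> 0" "orient p1 q1 r2 \<ge> 0" "orient p1 q2 r1 \<ge> 0" "orient p1 q2 r2 \<ge> 0"
    "orient p2 q1 r1 \<ge> 0" "orient p2 q1 r2 \<ge> 0" "orient p2 q2 r1 \<ge> 0" "orient p2 q2 r2 \<ge> 0"
    by (rule nonneg; simp)+
  moreover have "orient p q r \<in> {orient p1 q1 r1, orient p1 q1 r2, orient p1 q2 r1, orient p1 q2 r2,
      orient p2 q1 r1, orient p2 q1 r2, orient p2 q2 r1, orient p2 q2 r2}"
    using assms(2-4) by auto
  ultimately show ?thesis using pos by auto
qed

lemma sin_add_sin_minus_sin_add:
  fixes s t :: real
  shows "sin (2 * s) + sin (2 * t) - sin (2 * (s + t)) = 4 * sin s * sin t * sin (s + t)"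
proof -
  have "sin (2 * s) + sin (2 * t) - sin (2 * (s + t)) =
      sin (2 * s) * (1 - cos (2 * t)) + sin (2 * t) * (1 - cos (2 * s))"
    by (simp add: distrib_left sin_add algebra_simps)
  also have "\<dots> = 4 * sin s * sin t * sin (s + t)"
    unfolding sin_double cos_double_sin sin_add by (simp add: power2_eq_square algebra_simps)
  finally show ?thesis .
qed

lemma orient_circle:
  fixes x y z :: real
  shows "orient (cos (2 * x), sin (2 * x)) (cos (2 * y), sin (2 * y)) (cos (2 * z), sin (2 * z)) =
    4 * sin (y - x) * sin (z - y) * sin (z - x)"
proof -
  have "orient (cos (2 * x), sin (2 * x)) (cos (2 * y), sin (2 * y)) (cos (2 * z), sin (2 * z)) =
      sin (2 * y - 2 * x) + sin (2 * z - 2 * y) - sin (2 * z - 2 * x)"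
    by (simp add: orient_def sin_diff algebra_simps)
  also have "\<dots> = sin (2 * (y - x)) + sin (2 * (z - y)) - sin (2 * ((y - x) + (z - y)))"
    by (simp add: algebra_simps)
  also have "\<dots> = 4 * sin (y - x) * sin (z - y) * sin ((y - x) + (z - y))"
    by (rule sin_add_sin_minus_sin_add)
  finally show ?thesis by simp
qed

lemma orient_dc_outer:
  "orient (dc_outer k x) (dc_outer k y) (dc_outer k z) =
    4 * sin (pi * (real y - real x) / real k) * sin (pi * (real z - real y) / real k)
      * sin (pi * (real z - real x) / real k)"
  using orient_circle[of "pi * real x / real k" "pi * real y / real k" "pi * real z / real k"]
  by (simp add: dc_outer_def diff_divide_distrib right_diff_distrib mult.assoc)

lemma orient_dc_outer_nonneg:
  assumes "x \<le> y" "y \<le> z" "z \<le> x + k"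
  shows "orient (dc_outer k x) (dc_outer k y) (dc_outer k z) \<ge> 0"
proof -
  have "sin (pi * (real j - real i) / real k) \<ge> 0" if "i \<le> j" "j \<le> i + k" for i j
  proof (rule sin_ge_zero)
    have "pi * (real j - real i) \<le> pi * real k" using that by (intro mult_left_mono) auto
    then show "pi * (real j - real i) / real k \<le> pi" by (cases "k = 0") (simp_all add: divide_le_eq)
  qed (use that in simp)
  then show ?thesis unfolding orient_dc_outer using assms by (intro mult_nonneg_nonneg) auto
qed

lemma orient_dc_outer_pos:
  assumes "x < y" "y < z" "z < x + k"
  shows "orient (dc_outer k x) (dc_outer k y) (dc_outer k z) > 0"
proof -
  have "sin (pi * (real j - real i) / real k) > 0" if "i < j" "j < i + k" for i j
  proof (rule sin_gt_zero)
    have "pi * (real j - real i) < pi * real k" using that by (intro mult_strict_left_mono) auto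
    then show "pi * (real j - real i) / real k < pi" using that by (simp add: divide_less_eq)
  qed (use that in simp)
  then show ?thesis unfolding orient_dc_outer using assms by (intro mult_pos_pos) auto
qed

lemma dc_outer_period: "k > 0 \<Longrightarrow> dc_outer k k = dc_outer k 0"
  by (simp add: dc_outer_def)

lemma orient_dc_inner:
  "orient (dc_outer k i) (dc_inner k eps i) (dc_outer k (Suc i)) = - eps * sin (2 * pi / real k)"
proof -
  have "orient p ((1 - eps) *\<^sub>R midpoint p q) q = - eps * (fst p * snd q - snd p * fst q)" for p q
    by (simp add: orient_def midpoint_def field_simps)
  moreover have "fst (dc_outer k i) * snd (dc_outer k (Suc i)) -
      snd (dc_outer k i) * fst (dc_outer k (Suc i)) =
      sin (2 * pi * real (Suc i) / real k - 2 * pi * real i / real k)"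
    by (simp add: dc_outer_def sin_diff)
  moreover have "2 * pi * real (Suc i) / real k - 2 * pi * real i / real k = 2 * pi / real k"
    by (simp add: diff_divide_distrib[symmetric] algebra_simps)
  ultimately show ?thesis by (simp add: dc_inner_def)
qed

definition dc_vertex :: "nat \<Rightarrow> real \<Rightarrow> nat \<Rightarrow> point" where
  "dc_vertex k eps a = (if even a then dc_outer k (a div 2) else dc_inner k eps (a div 2))"

lemma double_circle_eq: "double_circle k eps = dc_vertex k eps ` {..<2 * k}"
proof -
  have "{..<2 * k} = (\<lambda>i. 2 * i) ` {..<k} \<union> (\<lambda>i. 2 * i + 1) ` {..<k}"
  proof (intro equalityI subsetI)
    fix a assume "a \<in> {..<2 * k}"
    then have "a div 2 < k" "a = 2 * (a div 2) \<or> a = 2 * (a div 2) + 1" by auto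
    then show "a \<in> (\<lambda>i. 2 * i) ` {..<k} \<union> (\<lambda>i. 2 * i + 1) ` {..<k}" by blast
  qed auto
  then show ?thesis
    by (simp only: image_Un image_image double_circle_def) (simp add: dc_vertex_def)
qed

abbreviation inner_indices :: "nat \<Rightarrow> nat set" where
  "inner_indices k \<equiv> {q. odd q \<and> q < 2 * k}"

abbreviation dc_dent :: "nat \<Rightarrow> nat \<Rightarrow> nat \<Rightarrow> nat \<Rightarrow> bool" where
  "dc_dent k \<equiv> dent (2 * k) (inner_indices k)"

lemma orient_dc_vertex_dent:
  assumes k: "k \<ge> 3" and "eps > 0" and dent: "dc_dent k a b c"
  shows "orient (dc_vertex k eps a) (dc_vertex k eps b) (dc_vertex k eps c) < 0"
proof -
  have "sin (2 * pi / real k) > 0"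
    using k by (intro sin_gt_zero) (auto simp: field_simps)
  then have neg: "orient (dc_outer k i) (dc_inner k eps i) (dc_outer k (Suc i)) < 0" for i
    unfolding orient_dc_inner using \<open>eps > 0\<close> by simp
  from dent consider (inner) "even a" "b = a + 1" "c = a + 2"
    | (last) "a = 0" "b = 2 * k - 2" "c = 2 * k - 1"
    by (auto simp: dent_def)
  then show ?thesis
  proof cases
    case inner
    then show ?thesis using neg[of "a div 2"] by (simp add: dc_vertex_def)
  next
    case last
    have "even b" "b div 2 = k - 1" "odd c" "c div 2 = k - 1" using last k by auto
    then show ?thesis
      using neg[of "k - 1"] last k
      by (simp add: dc_vertex_def orient_rotate[of "dc_outer k 0"] dc_outer_period)
  qed
qed

definition outer_neighbours :: "nat \<Rightarrow> nat set" where
  "outer_neighbours a = {a div 2, (a + 1) div 2}"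

lemma dc_vertex_0: "dc_vertex k 0 a = midpoint (dc_outer k (a div 2)) (dc_outer k ((a + 1) div 2))"
  by (auto simp: dc_vertex_def dc_inner_def elim!: oddE evenE)

lemma strictly_ordered_neighbours_no_wrap:
  assumes abc: "a < b" "b < c" and no_wrap: "(c + 1) div 2 < a div 2 + k"
    and no_dent: "\<not> (even a \<and> b = a + 1 \<and> c = a + 2)"
  obtains x y z where "x \<in> outer_neighbours a" "y \<in> outer_neighbours b" "z \<in> outer_neighbours c"
    "x < y" "y < z" "z < x + k"
proof (cases "a div 2 < b div 2")
  case True
  moreover have "b div 2 < (c + 1) div 2" using abc by linarith
  ultimately show thesis
    using that[of "a div 2" "b div 2" "(c + 1) div 2"] no_wrap by (simp add: outer_neighbours_def)
next
  case False
  then have "even a" "b = a + 1" using abc by presburger+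
  then have "a div 2 < (b + 1) div 2" "(b + 1) div 2 < (c + 1) div 2" using abc no_dent by auto
  then show thesis
    using that[of "a div 2" "(b + 1) div 2" "(c + 1) div 2"] no_wrap by (simp add: outer_neighbours_def)
qed

lemma strictly_ordered_neighbours_wrap:
  assumes k: "k \<ge> 3" and ab: "a < b" "a = 0 \<or> a = 1" and b: "b < 2 * k - 1"
    and no_dent: "\<not> (a = 0 \<and> b = 2 * k - 2)"
  obtains x y z where "x \<in> outer_neighbours a" "y \<in> outer_neighbours b"
    "z \<in> outer_neighbours (2 * k - 1)" "x < y" "y < z" "z < x + k"
proof -
  have last: "k - 1 \<in> outer_neighbours (2 * k - 1)" "k \<in> outer_neighbours (2 * k - 1)"
    using k by (auto simp: outer_neighbours_def)
  consider (zero_one) "a = 0" "b = 1" | (zero) "a = 0" "1 < b"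
    | (one_two) "a = 1" "b = 2" | (one) "a = 1" "2 < b"
    using ab by linarith
  then show thesis
  proof cases
    case zero_one
    then show thesis using that[OF _ _ last(1), of 0 1] k by (simp add: outer_neighbours_def)
  next
    case zero
    then have "0 < b div 2" "b div 2 < k - 1" using b no_dent by auto
    with zero show thesis
      using that[OF _ _ last(1), of 0 "b div 2"] k by (simp add: outer_neighbours_def)
  next
    case one_two
    then show thesis using that[OF _ _ last(1), of 0 1] k by (simp add: outer_neighbours_def)
  next
    case one
    then have "1 < (b + 1) div 2" "(b + 1) div 2 < k" using b by auto
    with one show thesis
      using that[OF _ _ last(2), of 1 "(b + 1) div 2"] by (simp add: outer_neighbours_def)
  qed
qed

lemma strictly_ordered_neighbours:
  assumes k: "k \<ge> 3" and abc: "a < b" "b < c" "c < 2 * k" and "\<not> dc_dent k a b c"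
  obtains x y z where "x \<in> outer_neighbours a" "y \<in> outer_neighbours b" "z \<in> outer_neighbours c"
    "x < y" "y < z" "z < x + k"
proof -
  have no_dent: "\<not> (even a \<and> b = a + 1 \<and> c = a + 2)" "\<not> (a = 0 \<and> b = 2 * k - 2 \<and> c = 2 * k - 1)"
    using assms by (auto simp: dent_def)
  consider (no_wrap) "(c + 1) div 2 < a div 2 + k" | (wrap) "a = 0 \<or> a = 1" "c = 2 * k - 1"
    using abc by linarith
  then show thesis
  proof cases
    case no_wrap
    then show thesis using strictly_ordered_neighbours_no_wrap[OF abc(1,2) _ no_dent(1)] that by blast
  next
    case wrap
    then show thesis using strictly_ordered_neighbours_wrap[OF k abc(1)] abc(2) no_dent(2) that by blast
  qed
qed

lemma orient_dc_vertex_0_pos: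
  assumes "k \<ge> 3" "a < b" "b < c" "c < 2 * k" "\<not> dc_dent k a b c"
  shows "orient (dc_vertex k 0 a) (dc_vertex k 0 b) (dc_vertex k 0 c) > 0"
proof -
  obtain x y z where xyz: "x \<in> outer_neighbours a" "y \<in> outer_neighbours b" "z \<in> outer_neighbours c"
    "x < y" "y < z" "z < x + k"
    using strictly_ordered_neighbours[OF assms] .
  have nonneg: "orient (dc_outer k x) (dc_outer k y) (dc_outer k z) \<ge> 0"
    if "x \<in> outer_neighbours a" "y \<in> outer_neighbours b" "z \<in> outer_neighbours c" for x y z
    using that assms by (intro orient_dc_outer_nonneg) (auto simp: outer_neighbours_def)
  show ?thesis
    unfolding dc_vertex_0
  proof (rule orient_midpoints_pos)
    show "orient (dc_outer k x) (dc_outer k y) (dc_outer k z) > 0"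
      using xyz by (intro orient_dc_outer_pos)
  qed (use xyz nonneg in \<open>unfold outer_neighbours_def, blast\<close>)+
qed

lemma continuous_on_orient_dc_vertex:
  "continuous_on UNIV (\<lambda>eps. orient (dc_vertex k eps a) (dc_vertex k eps b) (dc_vertex k eps c))"
proof -
  have "continuous_on UNIV (\<lambda>eps. dc_vertex k eps a)" for a
    by (cases "even a") (auto simp: dc_vertex_def dc_inner_def intro!: continuous_intros)
  then show ?thesis unfolding orient_def by (intro continuous_intros)
qed

lemma eventually_orient_dc_vertex_pos:
  assumes "k \<ge> 3" "a < b" "b < c" "c < 2 * k" "\<not> dc_dent k a b c"
  shows "eventually (\<lambda>eps. orient (dc_vertex k eps a) (dc_vertex k eps b) (dc_vertex k eps c) > 0)
    (at_right 0)"
proof -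
  have "((\<lambda>eps. orient (dc_vertex k eps a) (dc_vertex k eps b) (dc_vertex k eps c)) \<longlongrightarrow>
      orient (dc_vertex k 0 a) (dc_vertex k 0 b) (dc_vertex k 0 c)) (at_right 0)"
    using continuous_on_orient_dc_vertex[of k a b c]
    by (auto simp: continuous_on_def intro: tendsto_mono[OF at_le])
  then show ?thesis using orient_dc_vertex_0_pos[OF assms] by (rule order_tendstoD)
qed

lemma marked_polygon_double_circle: "k \<ge> 2 \<Longrightarrow> marked_polygon (2 * k) (inner_indices k)"
  by unfold_locales (auto simp: odd_pos)

lemma eventually_dented_polygon_dc_vertex:
  assumes k: "k \<ge> 3"
  shows "eventually (\<lambda>eps. dented_polygon (2 * k) (inner_indices k) (dc_vertex k eps)) (at_right 0)"
proof -
  let ?P = "\<lambda>eps (a, b, c). orient (dc_vertex k eps a) (dc_vertex k eps b) (dc_vertex k eps c) > 0"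
  define A where "A = {(a, b, c). a < b \<and> b < c \<and> c < 2 * k \<and> \<not> dc_dent k a b c}"
  have "finite A"
    by (rule finite_subset[of _ "{..<2*k} \<times> {..<2*k} \<times> {..<2*k}"]) (auto simp: A_def)
  moreover have "eventually (\<lambda>eps. ?P eps t) (at_right 0)" if "t \<in> A" for t
    using that eventually_orient_dc_vertex_pos[OF k] by (auto simp: A_def)
  ultimately have "eventually (\<lambda>eps. \<forall>t\<in>A. ?P eps t) (at_right 0)"
    by (intro eventually_ball_finite) auto
  moreover have "eventually (\<lambda>eps :: real. 0 < eps) (at_right 0)"
    by (rule eventually_at_right_less)
  ultimately show ?thesis
  proof eventually_elim
    case (elim eps)
    interpret marked_polygon "2 * k" "inner_indices k"
      using k by (intro marked_polygon_double_circle) simp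
    show ?case
      by unfold_locales (use elim orient_dc_vertex_dent[OF k] in \<open>force simp: A_def\<close>)+
  qed
qed

lemma num_tri_DC_eqI:
  assumes "eventually (\<lambda>eps. card (triangulations (double_circle k eps)) = n) (at_right 0)"
  shows "num_tri_DC k = n"
  unfolding num_tri_DC_def
proof (rule the_equality)
  show "eventually (\<lambda>eps. card (triangulations (double_circle k eps)) = n) (at_right 0)"
    by (rule assms)
  fix m assume "eventually (\<lambda>eps. card (triangulations (double_circle k eps)) = m) (at_right 0)"
  with assms have "eventually (\<lambda>eps :: real. m = n) (at_right 0)" by eventually_elim simp
  then show "m = n" by simp
qed

theorem num_tri_DC_eq_ear_free_count:
  assumes k: "k \<ge> 3"
  shows "int (num_tri_DC k) = ear_free_count (2 * k - 2) (inner_indices k)"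
proof -
  let ?M = "inner_indices k"
  have count: "eventually (\<lambda>eps. int (card (triangulations (double_circle k eps))) =
      ear_free_count (2 * k - 2) ?M) (at_right 0)"
    using eventually_dented_polygon_dc_vertex[OF k]
    by eventually_elim (simp add: double_circle_eq dented_polygon.card_triangulations)
  then have "num_tri_DC k = nat (ear_free_count (2 * k - 2) ?M)"
    by (intro num_tri_DC_eqI) (auto elim: eventually_mono)
  moreover have "ear_free_count (2 * k - 2) ?M \<ge> 0"
    using eventually_happens[OF count] by (auto simp flip: of_nat_0_le_iff)
  ultimately show ?thesis by simp
qed

subsection \<open>Catalan numbers as moments\<close>

text \<open>The coefficients of the power series of \<open>\<surd>(1 - 4 x) = 1 - 2 x (\<Sum>n. catalan n x\<^sup>n)\<close>.\<close>

definition sqrt_coeff :: "nat \<Rightarrow> real" where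
  "sqrt_coeff n = (1/2 gchoose n) * (-4) ^ n"

lemma sqrt_coeff_0: "sqrt_coeff 0 = 1"
  by (simp add: sqrt_coeff_def)

lemma sqrt_coeff_Suc: "real (Suc n) * sqrt_coeff (Suc n) = (4 * real n - 2) * sqrt_coeff n"
proof -
  have "real (Suc n) * (1/2 gchoose Suc n) = (1/2 - real n) * (1/2 gchoose n :: real)"
    using gbinomial_absorb_comp[of "1/2 :: real" n] gbinomial_absorption[of n "1/2 :: real"] by simp
  then have "real (Suc n) * (1/2 gchoose Suc n) * (-4) ^ Suc n =
      (1/2 - real n) * (1/2 gchoose n :: real) * (-4) ^ Suc n" by (simp only:)
  then show ?thesis by (simp add: sqrt_coeff_def algebra_simps)
qed

lemma sqrt_coeff_convolution: "(\<Sum>i\<le>n + 2. sqrt_coeff i * sqrt_coeff (n + 2 - i)) = 0"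
proof -
  have "(\<Sum>i\<le>n + 2. sqrt_coeff i * sqrt_coeff (n + 2 - i)) =
      (\<Sum>i\<le>n + 2. (1/2 gchoose i) * (1/2 gchoose (n + 2 - i))) * (-4) ^ (n + 2)"
    unfolding sum_distrib_right
  proof (rule sum.cong)
    fix i assume "i \<in> {..n + 2}"
    then have "(-4 :: real) ^ (n + 2) = (-4) ^ i * (-4) ^ (n + 2 - i)"
      by (simp add: power_add[symmetric])
    then show "sqrt_coeff i * sqrt_coeff (n + 2 - i) =
        (1/2 gchoose i) * (1/2 gchoose (n + 2 - i)) * (-4) ^ (n + 2)"
      by (simp add: sqrt_coeff_def)
  qed simp
  also have "(\<Sum>i\<le>n + 2. (1/2 gchoose i) * (1/2 gchoose (n + 2 - i)) :: real) = (1 gchoose (n + 2))"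
    using gbinomial_Vandermonde[of "1/2 :: real" "1/2" "n + 2"] by (simp add: atMost_atLeast0)
  also have "\<dots> = 0"
    using binomial_gbinomial[of 1 "n + 2", where 'a = real] by simp
  finally show ?thesis by simp
qed

lemma sqrt_coeff_Suc_eq_catalan: "sqrt_coeff (Suc n) = - 2 * real (catalan n)"
proof (induction n rule: less_induct)
  case (less n)
  show ?case
  proof (cases n)
    case 0
    then show ?thesis by (simp add: sqrt_coeff_def)
  next
    case (Suc m)
    have "0 = (\<Sum>i\<le>Suc (Suc m). sqrt_coeff i * sqrt_coeff (Suc (Suc m) - i))"
      using sqrt_coeff_convolution[of m] by simp
    also have "\<dots> = 2 * sqrt_coeff (Suc (Suc m)) + (\<Sum>i\<le>m. sqrt_coeff (Suc i) * sqrt_coeff (Suc m - i))"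
      by (subst sum.atMost_Suc_shift) (simp add: sqrt_coeff_0)
    also have "(\<Sum>i\<le>m. sqrt_coeff (Suc i) * sqrt_coeff (Suc m - i)) =
        (\<Sum>i\<le>m. 4 * real (catalan i * catalan (m - i)))"
      by (intro sum.cong) (auto simp: less Suc Suc_diff_le)
    also have "\<dots> = 4 * real (catalan (Suc m))"
      by (simp add: sum_distrib_left)
    finally show ?thesis by (simp only: Suc)
  qed
qed

lemma catalan_Suc_mult: "real (n + 2) * real (catalan (Suc n)) = real (4 * n + 2) * real (catalan n)"
  using sqrt_coeff_Suc[of "Suc n"] by (simp add: sqrt_coeff_Suc_eq_catalan algebra_simps)

definition catalan_mean :: "(real \<Rightarrow> real) \<Rightarrow> real" where
  "catalan_mean f = 4 / pi * integral {0..pi/2} (\<lambda>t. f (4 * (cos t)\<^sup>2) * (sin t)\<^sup>2)"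

lemma catalan_mean_integrable:
  assumes "continuous_on UNIV f"
  shows "(\<lambda>t. f (4 * (cos t)\<^sup>2) * (sin t)\<^sup>2) integrable_on {0..pi/2}"
  by (intro integrable_continuous_real continuous_intros continuous_on_compose2[OF assms]) auto

lemma catalan_mean_cmult: "catalan_mean (\<lambda>x. c * f x) = c * catalan_mean f"
  by (simp add: catalan_mean_def mult.assoc)

lemma catalan_mean_diff:
  assumes "continuous_on UNIV f" "continuous_on UNIV g"
  shows "catalan_mean (\<lambda>x. f x - g x) = catalan_mean f - catalan_mean g"
  using integral_diff[OF assms[THEN catalan_mean_integrable]]
  by (simp add: catalan_mean_def left_diff_distrib right_diff_distrib)

lemma catalan_mean_one: "catalan_mean (\<lambda>x. 1) = 1"
proof -
  have "((\<lambda>t. (sin t)\<^sup>2) has_integral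
      ((pi/2 - sin (pi/2) * cos (pi/2)) / 2 - (0 - sin 0 * cos 0) / 2)) {0..pi/2}"
  proof (rule fundamental_theorem_of_calculus)
    fix t :: real
    have "((\<lambda>t. (t - sin t * cos t) / 2) has_real_derivative (1 - ((cos t)\<^sup>2 - (sin t)\<^sup>2)) / 2)
        (at t within {0..pi/2})"
      by (auto intro!: derivative_eq_intros simp: power2_eq_square)
    also have "(1 - ((cos t)\<^sup>2 - (sin t)\<^sup>2)) / 2 = (sin t)\<^sup>2" by (simp add: cos_squared_eq)
    finally show "((\<lambda>t. (t - sin t * cos t) / 2) has_vector_derivative (sin t)\<^sup>2) (at t within {0..pi/2})"
      by (simp add: has_real_derivative_iff_has_vector_derivative)
  qed simp
  then show ?thesis by (simp add: catalan_mean_def integral_unique)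
qed

lemma DERIV_sin_cube_cos_power:
  "((\<lambda>t. 2 * 4 ^ m * sin t ^ 3 * cos t ^ (2 * m + 1)) has_real_derivative
    (real (m + 2) * (4 * (cos t)\<^sup>2) ^ Suc m - real (4 * m + 2) * (4 * (cos t)\<^sup>2) ^ m) * (sin t)\<^sup>2)
    (at t within A)"
proof -
  have "((\<lambda>t. 2 * 4 ^ m * sin t ^ 3 * cos t ^ (2 * m + 1)) has_real_derivative
      2 * 4 ^ m * (3 * (sin t)\<^sup>2 * cos t * cos t ^ (2 * m + 1)
        - sin t ^ 3 * (real (2 * m + 1) * cos t ^ (2 * m) * sin t))) (at t within A)"
    by (rule derivative_eq_intros refl)+ (simp add: algebra_simps eval_nat_numeral)
  also have "sin t ^ 3 * (real (2 * m + 1) * cos t ^ (2 * m) * sin t)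
      = (sin t)\<^sup>2 * (1 - (cos t)\<^sup>2) * (real (2 * m + 1) * cos t ^ (2 * m))"
    unfolding sin_squared_eq[of t, symmetric] by (simp add: eval_nat_numeral algebra_simps)
  also have "2 * 4 ^ m * (3 * (sin t)\<^sup>2 * cos t * cos t ^ (2 * m + 1) -
      (sin t)\<^sup>2 * (1 - (cos t)\<^sup>2) * (real (2 * m + 1) * cos t ^ (2 * m)))
    = (real (m + 2) * (4 * (cos t)\<^sup>2) ^ Suc m - real (4 * m + 2) * (4 * (cos t)\<^sup>2) ^ m) * (sin t)\<^sup>2"
  proof -
    have "cos t ^ (2 * m) = cos t ^ m * cos t ^ m" by (simp add: mult_2 power_add)
    then show ?thesis by (simp add: power_mult_distrib algebra_simps power2_eq_square)
  qed
  finally show ?thesis .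
qed

lemma catalan_mean_power_Suc:
  "real (m + 2) * catalan_mean (\<lambda>x. x ^ Suc m) = real (4 * m + 2) * catalan_mean (\<lambda>x. x ^ m)"
proof -
  define F where "F t = 2 * 4 ^ m * sin t ^ 3 * cos t ^ (2 * m + 1)" for t :: real
  have "((\<lambda>t. (real (m + 2) * (4 * (cos t)\<^sup>2) ^ Suc m - real (4 * m + 2) * (4 * (cos t)\<^sup>2) ^ m) * (sin t)\<^sup>2)
      has_integral (F (pi/2) - F 0)) {0..pi/2}"
    unfolding F_def
    by (intro fundamental_theorem_of_calculus)
      (auto simp only: has_real_derivative_iff_has_vector_derivative[symmetric] pi_half_ge_zero
        intro!: DERIV_sin_cube_cos_power)
  then have "catalan_mean (\<lambda>x. real (m + 2) * x ^ Suc m - real (4 * m + 2) * x ^ m) = 0"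
    unfolding catalan_mean_def by (subst integral_unique) (auto simp: F_def)
  moreover have "catalan_mean (\<lambda>x. real (m + 2) * x ^ Suc m - real (4 * m + 2) * x ^ m) =
      real (m + 2) * catalan_mean (\<lambda>x. x ^ Suc m) - real (4 * m + 2) * catalan_mean (\<lambda>x. x ^ m)"
    by (subst catalan_mean_diff) (auto simp only: catalan_mean_cmult intro!: continuous_intros)
  ultimately show ?thesis by linarith
qed

lemma catalan_mean_power: "catalan_mean (\<lambda>x. x ^ n) = real (catalan n)"
proof (induction n)
  case 0
  then show ?case by (simp add: catalan_mean_one)
next
  case (Suc n)
  have "real (n + 2) * catalan_mean (\<lambda>x. x ^ Suc n) = real (n + 2) * real (catalan (Suc n))"
    by (simp only: catalan_mean_power_Suc Suc.IH catalan_Suc_mult)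
  moreover have "real (n + 2) \<noteq> 0" by simp
  ultimately show ?case by (simp only: mult_cancel_left) simp
qed

lemma ear_free_count_eq_catalan_mean:
  assumes "finite B" "card B \<le> m"
  shows "real_of_int (ear_free_count m B) = catalan_mean (\<lambda>x. x ^ (m - card B) * (x - 1) ^ card B)"
  using assms
proof (induction B arbitrary: m)
  case empty
  then show ?case by (simp add: ear_free_count_empty catalan_mean_power)
next
  case (insert q B)
  define e where "e = card B"
  have e: "card (insert q B) = Suc e" "Suc e \<le> m" using insert by (simp_all add: e_def)
  have "real_of_int (ear_free_count m (insert q B)) =
      catalan_mean (\<lambda>x. x ^ (m - e) * (x - 1) ^ e) - catalan_mean (\<lambda>x. x ^ (m - 1 - e) * (x - 1) ^ e)"
    using insert.IH[of m] insert.IH[of "m - 1"] insert.hyps e by (simp add: ear_free_count_insert e_def)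
  also have "\<dots> = catalan_mean (\<lambda>x. x ^ (m - e) * (x - 1) ^ e - x ^ (m - 1 - e) * (x - 1) ^ e)"
    by (intro catalan_mean_diff[symmetric] continuous_intros)
  also have "(\<lambda>x :: real. x ^ (m - e) * (x - 1) ^ e - x ^ (m - 1 - e) * (x - 1) ^ e) =
      (\<lambda>x. x ^ (m - Suc e) * (x - 1) ^ Suc e)"
  proof
    fix x :: real
    have "m - e = Suc (m - Suc e)" "m - 1 - e = m - Suc e" using e by simp_all
    then show "x ^ (m - e) * (x - 1) ^ e - x ^ (m - 1 - e) * (x - 1) ^ e =
        x ^ (m - Suc e) * (x - 1) ^ Suc e"
      by (simp add: algebra_simps)
  qed
  finally show ?case by (simp only: e)
qed

subsection \<open>Laplace's method\<close>

lemma continuous_on_extend_left: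
  fixes f :: "real \<Rightarrow> real"
  assumes cont: "continuous_on {a<..b} f" and lim: "(f \<longlongrightarrow> l) (at_right a)"
  shows "continuous_on {a..b} (f(a := l))"
  unfolding continuous_on_def
proof
  fix x assume x: "x \<in> {a..b}"
  show "(f(a := l) \<longlongrightarrow> (f(a := l)) x) (at x within {a..b})"
  proof (cases "x = a")
    case True
    have "(f(a := l) \<longlongrightarrow> l) (at_right a)"
      by (rule Lim_transform_eventually[OF lim]) (auto simp: eventually_at_filter)
    moreover have "at a within {a..b} \<le> at_right a"
      unfolding at_within_def by (intro inf_mono order_refl) auto
    ultimately show ?thesis using True by (auto intro: tendsto_mono)
  next
    case False
    have "(f \<longlongrightarrow> f x) (at x within {a<..b})" using cont x False by (auto simp: continuous_on_def)
    moreover have "at x within {a..b} = at x within {a<..b}"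
      using x False by (intro at_within_nhd[of x "{a<..}"]) auto
    moreover have "eventually (\<lambda>y. f y = (f(a := l)) y) (at x within {a<..b})"
      by (auto simp: eventually_at_filter)
    ultimately show ?thesis using False by (auto elim: Lim_transform_eventually)
  qed
qed

lemma gaussian_second_moment:
  fixes a :: real
  assumes "a > 0"
  shows "has_bochner_integral lborel (\<lambda>s. indicator {0..} s * (s\<^sup>2 * exp (- (a * s\<^sup>2))))
    (sqrt pi / (4 * a * sqrt a))"
proof -
  let ?g = "\<lambda>x::real. indicator {0..} x *\<^sub>R (exp (-x\<^sup>2) * x ^ (2 * 1))"
  have "has_bochner_integral lborel ?g (sqrt pi / 4)"
    using gaussian_moment_even_pos[of 1] by simp
  then have "has_bochner_integral lborel (\<lambda>x. ?g (0 + sqrt a * x)) ((sqrt pi / 4) /\<^sub>R \<bar>sqrt a\<bar>)"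
    using assms by (subst lborel_has_bochner_integral_real_affine_iff[symmetric]) auto
  then have "has_bochner_integral lborel (\<lambda>x. (1 / a) * ?g (0 + sqrt a * x))
      ((1 / a) * ((sqrt pi / 4) /\<^sub>R \<bar>sqrt a\<bar>))"
    by (rule has_bochner_integral_mult_right)
  moreover have "(1 / a) * ?g (0 + sqrt a * x) = indicator {0..} x * (x\<^sup>2 * exp (- (a * x\<^sup>2)))" for x
    using assms by (auto simp: indicator_def power_mult_distrib zero_le_mult_iff)
  moreover have "(1 / a) * ((sqrt pi / 4) /\<^sub>R \<bar>sqrt a\<bar>) = sqrt pi / (4 * a * sqrt a)"
    using assms by (simp add: field_simps)
  ultimately show ?thesis by (simp only:)
qed

locale laplace_integral =
  fixes b a A :: real and \<phi> \<psi> :: "real \<Rightarrow> real"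
  assumes b_pos: "b > 0" and a_pos: "a > 0"
    and cont_phase: "continuous_on {0..b} \<phi>" and cont_amplitude: "continuous_on {0..b} \<psi>"
    and phase_less_1: "t \<in> {0<..b} \<Longrightarrow> \<bar>\<phi> t\<bar> < 1"
    and phase_at_0: "((\<lambda>t. (1 - \<phi> t) / t\<^sup>2) \<longlongrightarrow> a) (at_right 0)"
    and amplitude_at_0: "((\<lambda>t. \<psi> t / t\<^sup>2) \<longlongrightarrow> A) (at_right 0)"
begin

lemma eventually_phase_pos: "eventually (\<lambda>t. 0 < \<phi> t) (at_right 0)"
proof -
  have "((\<lambda>t. 1 - (1 - \<phi> t) / t\<^sup>2 * t\<^sup>2) \<longlongrightarrow> 1 - a * 0\<^sup>2) (at_right 0)"
    by (intro tendsto_intros phase_at_0)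
  then have "eventually (\<lambda>t. 0 < 1 - (1 - \<phi> t) / t\<^sup>2 * t\<^sup>2) (at_right 0)"
    by (rule order_tendstoD) simp
  then show ?thesis
    using eventually_at_right_less[of 0] by eventually_elim simp
qed

lemma phase_gaussian_bound:
  obtains c where "c > 0" "\<And>t. t \<in> {0<..b} \<Longrightarrow> \<bar>\<phi> t\<bar> \<le> exp (- (c * t\<^sup>2))"
proof -
  define g where "g = (\<lambda>t. (1 - \<bar>\<phi> t\<bar>) / t\<^sup>2)(0 := a)"
  have "((\<lambda>t. (1 - \<bar>\<phi> t\<bar>) / t\<^sup>2) \<longlongrightarrow> a) (at_right 0)"
    by (rule Lim_transform_eventually[OF phase_at_0])
      (use eventually_phase_pos in eventually_elim, simp)
  moreover have "continuous_on {0<..b} (\<lambda>t. (1 - \<bar>\<phi> t\<bar>) / t\<^sup>2)"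
    by (intro continuous_intros continuous_on_subset[OF cont_phase]) auto
  ultimately have "continuous_on {0..b} g"
    unfolding g_def by (intro continuous_on_extend_left)
  then obtain m where m: "m \<in> {0..b}" "\<And>t. t \<in> {0..b} \<Longrightarrow> g m \<le> g t"
    using continuous_attains_inf[of "{0..b}" g] b_pos by auto
  have "g m > 0"
    using m(1) a_pos phase_less_1[of m] by (auto simp: g_def)
  moreover have "\<bar>\<phi> t\<bar> \<le> exp (- (g m * t\<^sup>2))" if "t \<in> {0<..b}" for t
  proof -
    have "g m * t\<^sup>2 \<le> 1 - \<bar>\<phi> t\<bar>" using m(2)[of t] that by (simp add: g_def field_simps)
    then have "\<bar>\<phi> t\<bar> \<le> 1 + - (g m * t\<^sup>2)" by simp
    also have "\<dots> \<le> exp (- (g m * t\<^sup>2))" by (rule exp_ge_add_one_self)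
    finally show ?thesis .
  qed
  ultimately show thesis using that by blast
qed

lemma amplitude_quadratic_bound:
  obtains C where "\<And>t. t \<in> {0<..b} \<Longrightarrow> \<bar>\<psi> t\<bar> \<le> C * t\<^sup>2"
proof -
  define g where "g = (\<lambda>t. \<psi> t / t\<^sup>2)(0 := A)"
  have "continuous_on {0<..b} (\<lambda>t. \<psi> t / t\<^sup>2)"
    by (intro continuous_intros continuous_on_subset[OF cont_amplitude]) auto
  then have "continuous_on {0..b} g"
    unfolding g_def using amplitude_at_0 by (rule continuous_on_extend_left)
  then have "bounded (g ` {0..b})"
    by (intro compact_imp_bounded compact_continuous_image compact_Icc)
  then obtain C where C: "\<forall>t\<in>{0..b}. \<bar>g t\<bar> \<le> C"
    by (auto simp: bounded_iff)
  have "\<bar>\<psi> t\<bar> \<le> C * t\<^sup>2" if "t \<in> {0<..b}" for t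
    using bspec[OF C, of t] that by (simp add: g_def abs_divide field_simps)
  then show thesis using that by blast
qed

lemma scaled_at_right_0: "s > 0 \<Longrightarrow> filterlim (\<lambda>k. s / sqrt (real k)) (at_right 0) at_top"
  by real_asymp

lemma scaled_amplitude_tendsto:
  assumes "s > 0"
  shows "(\<lambda>k. real k * \<psi> (s / sqrt (real k))) \<longlonglongrightarrow> A * s\<^sup>2"
proof -
  have "(\<lambda>k. \<psi> (s / sqrt (real k)) / (s / sqrt (real k))\<^sup>2 * s\<^sup>2) \<longlonglongrightarrow> A * s\<^sup>2"
    by (intro tendsto_mult tendsto_const filterlim_compose[OF amplitude_at_0 scaled_at_right_0[OF assms]])
  then show ?thesis
    by (rule Lim_transform_eventually)
      (use eventually_gt_at_top[of 0] in eventually_elim, use assms in \<open>simp add: power_divide\<close>)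
qed

text \<open>\<open>\<phi>\<^sup>k\<close> is compared with \<open>(exp (- a t\<^sup>2))\<^sup>k\<close>, as \<open>\<bar>z\<^sup>k - w\<^sup>k\<bar> \<le> k \<bar>z - w\<bar>\<close> for \<open>z\<close>, \<open>w\<close> in the unit disc.\<close>

lemma scaled_phase_power_tendsto:
  assumes s: "s > 0"
  shows "(\<lambda>k. \<phi> (s / sqrt (real k)) ^ k) \<longlonglongrightarrow> exp (- (a * s\<^sup>2))"
proof -
  let ?t = "\<lambda>k. s / sqrt (real k)"
  let ?err = "\<lambda>t. (1 - exp (- (a * t\<^sup>2))) / t\<^sup>2 - (1 - \<phi> t) / t\<^sup>2"
  have "((\<lambda>t. (1 - exp (- (a * t\<^sup>2))) / t\<^sup>2) \<longlongrightarrow> a) (at_right 0)"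
    using a_pos by real_asymp
  then have "(?err \<longlongrightarrow> a - a) (at_right 0)" by (rule tendsto_diff[OF _ phase_at_0])
  then have "(\<lambda>k. ?err (?t k)) \<longlonglongrightarrow> a - a"
    using scaled_at_right_0[OF s] by (rule filterlim_compose)
  then have "(\<lambda>k. s\<^sup>2 * norm (?err (?t k))) \<longlonglongrightarrow> 0"
    by (intro tendsto_mult_right_zero tendsto_norm_zero) simp
  moreover have "eventually (\<lambda>k. norm (\<phi> (?t k) ^ k - exp (- (a * s\<^sup>2))) \<le> s\<^sup>2 * norm (?err (?t k))) at_top"
    using eventually_compose_filterlim[OF eventually_at_right_real[OF b_pos] scaled_at_right_0[OF s]]
      eventually_gt_at_top[of 0]
  proof eventually_elim
    case (elim k)
    define t where "t = ?t k"
    have t: "t \<in> {0<..b}" and s_eq: "s\<^sup>2 = real k * t\<^sup>2"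
      using elim by (auto simp: t_def power_divide)
    have "norm (\<phi> t ^ k - exp (- (a * t\<^sup>2)) ^ k) \<le> real k * norm (\<phi> t - exp (- (a * t\<^sup>2)))"
      using phase_less_1[OF t] a_pos by (intro norm_power_diff) auto
    moreover have "exp (- (a * t\<^sup>2)) ^ k = exp (- (a * s\<^sup>2))"
      by (simp add: s_eq exp_of_nat_mult[symmetric] mult_ac)
    moreover have "?err t = (\<phi> t - exp (- (a * t\<^sup>2))) / t\<^sup>2"
      by (simp add: diff_divide_distrib)
    ultimately show ?case
      using t unfolding t_def[symmetric] by (simp add: s_eq)
  qed
  ultimately have "(\<lambda>k. \<phi> (?t k) ^ k - exp (- (a * s\<^sup>2))) \<longlonglongrightarrow> 0"
    by (rule Lim_null_comparison[rotated])
  then show ?thesis by (simp add: LIM_zero_iff)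
qed

definition scaled_integrand :: "nat \<Rightarrow> real \<Rightarrow> real" where
  "scaled_integrand k s = indicator {0..b} (s / sqrt (real k)) *
    (real k * \<psi> (s / sqrt (real k)) * \<phi> (s / sqrt (real k)) ^ k)"

lemma scaled_integrand_tendsto:
  assumes "s \<noteq> 0"
  shows "(\<lambda>k. scaled_integrand k s) \<longlonglongrightarrow> A * (indicator {0..} s * (s\<^sup>2 * exp (- (a * s\<^sup>2))))"
proof (cases "s > 0")
  case True
  have "((\<lambda>k. s / sqrt (real k)) \<longlongrightarrow> 0) at_top" by real_asymp
  then have "eventually (\<lambda>k. s / sqrt (real k) < b) at_top"
    using b_pos by (rule order_tendstoD)
  then have "eventually (\<lambda>k. real k * \<psi> (s / sqrt (real k)) * \<phi> (s / sqrt (real k)) ^ k =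
      scaled_integrand k s) at_top"
    by eventually_elim (use True in \<open>simp add: scaled_integrand_def\<close>)
  moreover have "(\<lambda>k. real k * \<psi> (s / sqrt (real k)) * \<phi> (s / sqrt (real k)) ^ k) \<longlonglongrightarrow>
      A * s\<^sup>2 * exp (- (a * s\<^sup>2))"
    by (intro tendsto_mult scaled_amplitude_tendsto scaled_phase_power_tendsto True)
  ultimately show ?thesis using True by (simp add: mult.assoc Lim_transform_eventually)
next
  case False
  have "eventually (\<lambda>k. scaled_integrand k s = 0) at_top"
    using eventually_gt_at_top[of 0]
    by eventually_elim
      (use False assms in \<open>simp add: scaled_integrand_def indicator_def zero_le_divide_iff\<close>)
  then show ?thesis using False assms by (simp add: tendsto_eventually)
qed

lemma scaled_integrand_bound:
  obtains c C where "c > 0"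
    "\<And>k s. s \<noteq> 0 \<Longrightarrow> \<bar>scaled_integrand k s\<bar> \<le> C * (indicator {0..} s * (s\<^sup>2 * exp (- (c * s\<^sup>2))))"
proof -
  obtain c where c: "c > 0" "\<And>t. t \<in> {0<..b} \<Longrightarrow> \<bar>\<phi> t\<bar> \<le> exp (- (c * t\<^sup>2))"
    using phase_gaussian_bound by blast
  obtain C where C: "\<And>t. t \<in> {0<..b} \<Longrightarrow> \<bar>\<psi> t\<bar> \<le> C * t\<^sup>2"
    using amplitude_quadratic_bound by blast
  have "C * b\<^sup>2 \<ge> 0" using C[of b] b_pos by simp
  then have "C \<ge> 0" using b_pos by (simp add: zero_le_mult_iff)
  have "\<bar>scaled_integrand k s\<bar> \<le> C * (indicator {0..} s * (s\<^sup>2 * exp (- (c * s\<^sup>2))))" if "s \<noteq> 0" for k s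
  proof (cases "k > 0 \<and> s / sqrt (real k) \<in> {0..b}")
    case True
    define t where "t = s / sqrt (real k)"
    have "t \<noteq> 0" "t \<in> {0..b}" using True that by (simp_all add: t_def)
    then have t: "t \<in> {0<..b}" by auto
    have s: "s\<^sup>2 = real k * t\<^sup>2" "0 \<le> s"
      using True by (auto simp: t_def power_divide zero_le_divide_iff)
    have "\<bar>scaled_integrand k s\<bar> = real k * \<bar>\<psi> t\<bar> * \<bar>\<phi> t\<bar> ^ k"
      using True unfolding scaled_integrand_def t_def[symmetric] by (simp add: abs_mult power_abs)
    also have "\<dots> \<le> real k * (C * t\<^sup>2) * exp (- (c * t\<^sup>2)) ^ k"
      using c(2)[OF t] C[OF t] by (intro mult_mono power_mono) auto
    also have "\<dots> = C * (s\<^sup>2 * exp (- (c * s\<^sup>2)))"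
      by (simp add: s(1) exp_of_nat_mult[symmetric] algebra_simps)
    finally show ?thesis using s(2) by simp
  next
    case False
    then have "scaled_integrand k s = 0" by (auto simp: scaled_integrand_def)
    then show ?thesis using \<open>C \<ge> 0\<close> by simp
  qed
  with c(1) show thesis using that by blast
qed

lemma scaled_integrand_measurable: "scaled_integrand k \<in> borel_measurable borel"
proof -
  define h where "h t = indicator {0..b} t *\<^sub>R (\<psi> t * \<phi> t ^ k)" for t
  have [measurable]: "h \<in> borel_measurable borel"
    unfolding h_def
    by (intro borel_measurable_continuous_on_indicator continuous_intros cont_phase cont_amplitude) simp
  have "scaled_integrand k = (\<lambda>s. real k * h (s / sqrt (real k)))"
    by (auto simp: scaled_integrand_def h_def)
  then show ?thesis by simp
qed

lemma scaled_integrand_integral: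
  assumes "k > 0"
  shows "(\<integral>s. scaled_integrand k s \<partial>lborel) = real k powr (3/2) * integral {0..b} (\<lambda>t. \<phi> t ^ k * \<psi> t)"
proof -
  let ?f = "\<lambda>t. indicator {0..b} t * (\<phi> t ^ k * \<psi> t)"
  have cont: "continuous_on {0..b} (\<lambda>t. \<phi> t ^ k * \<psi> t)"
    by (intro continuous_intros cont_phase cont_amplitude)
  have "integral {0..b} (\<lambda>t. \<phi> t ^ k * \<psi> t) = (\<integral>t. ?f t \<partial>lborel)"
    using set_borel_integral_eq_integral(2)[OF borel_integrable_atLeastAtMost'[OF cont]]
    by (simp add: set_lebesgue_integral_def)
  also have "\<dots> = 1 / sqrt (real k) * (\<integral>s. ?f (s / sqrt (real k)) \<partial>lborel)"
    using lborel_integral_real_affine[of "1 / sqrt (real k)" ?f 0] assms by simp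
  finally have "real k powr (3/2) * integral {0..b} (\<lambda>t. \<phi> t ^ k * \<psi> t) =
      real k powr (3/2) / sqrt (real k) * (\<integral>s. ?f (s / sqrt (real k)) \<partial>lborel)" by simp
  also have "real k powr (3/2) / sqrt (real k) = real k"
    using assms by (simp add: powr_half_sqrt[symmetric] powr_diff[symmetric])
  also have "real k * (\<integral>s. ?f (s / sqrt (real k)) \<partial>lborel) = (\<integral>s. scaled_integrand k s \<partial>lborel)"
    unfolding scaled_integrand_def by (subst integral_mult_right_zero[symmetric]) (simp add: mult_ac)
  finally show ?thesis ..
qed

theorem laplace_integral_tendsto:
  "(\<lambda>k. real k powr (3/2) * integral {0..b} (\<lambda>t. \<phi> t ^ k * \<psi> t)) \<longlonglongrightarrow> A * (sqrt pi / (4 * a * sqrt a))"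
proof -
  let ?g = "\<lambda>a s::real. indicator {0..} s * (s\<^sup>2 * exp (- (a * s\<^sup>2)))"
  obtain c C where c: "c > 0" and bound: "\<And>k s. s \<noteq> 0 \<Longrightarrow> \<bar>scaled_integrand k s\<bar> \<le> C * ?g c s"
    using scaled_integrand_bound by blast
  have "(\<lambda>k. \<integral>s. scaled_integrand k s \<partial>lborel) \<longlonglongrightarrow> (\<integral>s. A * ?g a s \<partial>lborel)"
  proof (rule integral_dominated_convergence[where w = "\<lambda>s. C * ?g c s"])
    show "integrable lborel (\<lambda>s. C * ?g c s)"
      using gaussian_second_moment[OF c] by (simp add: has_bochner_integral_iff)
    show "AE s in lborel. (\<lambda>k. scaled_integrand k s) \<longlonglongrightarrow> A * ?g a s"
      using AE_lborel_singleton[of 0] by eventually_elim (rule scaled_integrand_tendsto)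
    show "AE s in lborel. norm (scaled_integrand k s) \<le> C * ?g c s" for k
      using AE_lborel_singleton[of 0] by eventually_elim (simp add: bound)
  qed (simp_all add: scaled_integrand_measurable)
  also have "(\<integral>s. A * ?g a s \<partial>lborel) = A * (sqrt pi / (4 * a * sqrt a))"
    using gaussian_second_moment[OF a_pos] by (simp add: has_bochner_integral_iff)
  finally show ?thesis
    by (rule Lim_transform_eventually)
      (use eventually_gt_at_top[of 0] in eventually_elim, simp add: scaled_integrand_integral)
qed

corollary laplace_integral_asymp_equiv:
  assumes "A \<noteq> 0"
  shows "(\<lambda>k. integral {0..b} (\<lambda>t. \<phi> t ^ k * \<psi> t)) \<sim>[at_top]
    (\<lambda>k. A * (sqrt pi / (4 * a * sqrt a)) * real k powr (-3/2))"
proof -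
  let ?I = "\<lambda>k. integral {0..b} (\<lambda>t. \<phi> t ^ k * \<psi> t)"
  have "?I \<sim>[at_top] (\<lambda>k. real k powr (3/2) * ?I k * real k powr (-3/2))"
  proof (rule asymp_equiv_refl_ev)
    show "eventually (\<lambda>k. ?I k = real k powr (3/2) * ?I k * real k powr (-3/2)) at_top"
      using eventually_gt_at_top[of 0]
      by eventually_elim (simp add: powr_minus)
  qed
  moreover have "(\<lambda>k. real k powr (3/2) * ?I k) \<sim>[at_top] (\<lambda>_. A * (sqrt pi / (4 * a * sqrt a)))"
    using laplace_integral_tendsto assms a_pos by (intro tendsto_imp_asymp_equiv_const) auto
  then have "(\<lambda>k. real k powr (3/2) * ?I k * real k powr (-3/2)) \<sim>[at_top]
      (\<lambda>k. A * (sqrt pi / (4 * a * sqrt a)) * real k powr (-3/2))"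
    by (rule asymp_equiv_mult[OF _ asymp_equiv_refl])
  ultimately show ?thesis by (rule asymp_equiv_trans)
qed

end

subsection \<open>Asymptotics of the double circle\<close>

lemma card_inner_indices: "card (inner_indices k) = k"
proof -
  have "inner_indices k = (\<lambda>i. 2 * i + 1) ` {..<k}"
    by (auto elim!: oddE)
  then show ?thesis by (simp add: card_image inj_on_def)
qed

lemma num_tri_DC_eq_catalan_mean:
  assumes "k \<ge> 3"
  shows "real (num_tri_DC k) = catalan_mean (\<lambda>x. x ^ (k - 2) * (x - 1) ^ k)"
proof -
  have "real (num_tri_DC k) = real_of_int (ear_free_count (2 * k - 2) (inner_indices k))"
    using num_tri_DC_eq_ear_free_count[OF assms] by (metis of_int_of_nat_eq)
  also have "\<dots> = catalan_mean (\<lambda>x. x ^ (2 * k - 2 - k) * (x - 1) ^ k)"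
    using ear_free_count_eq_catalan_mean[of "inner_indices k" "2 * k - 2"] assms
    by (simp add: card_inner_indices)
  also have "2 * k - 2 - k = k - 2" by simp
  finally show ?thesis .
qed

definition dc_phase :: "real \<Rightarrow> real" where
  "dc_phase t = (cos t)\<^sup>2 * (4 * (cos t)\<^sup>2 - 1) / 3"

definition dc_amplitude :: "real \<Rightarrow> real" where
  "dc_amplitude t = (4 * (cos t)\<^sup>2 - 1)\<^sup>2 * (sin t)\<^sup>2"

lemma abs_dc_phase_less_1:
  assumes "t \<in> {0<..pi/2}"
  shows "\<bar>dc_phase t\<bar> < 1"
proof -
  define x where "x = (cos t)\<^sup>2"
  have "sin t > 0" using assms by (intro sin_gt_zero) auto
  then have "(sin t)\<^sup>2 > 0" by simp
  then have x: "0 \<le> x" "x < 1"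
    using sin_cos_squared_add[of t] unfolding x_def by (simp, linarith)
  then have "\<bar>dc_phase t\<bar> = x * (\<bar>4 * x - 1\<bar> / 3)"
    by (simp add: dc_phase_def x_def abs_mult)
  also have "\<dots> \<le> x * 1" using x by (intro mult_left_mono) auto
  finally show ?thesis using x by simp
qed

lemma laplace_integral_double_circle: "laplace_integral (pi/2) (7/3) 9 dc_phase dc_amplitude"
proof
  show "((\<lambda>t. (1 - dc_phase t) / t\<^sup>2) \<longlongrightarrow> 7/3) (at_right 0)"
    unfolding dc_phase_def by real_asymp
  show "((\<lambda>t. dc_amplitude t / t\<^sup>2) \<longlongrightarrow> 9) (at_right 0)"
    unfolding dc_amplitude_def by real_asymp
  show "continuous_on {0..pi/2} dc_phase" "continuous_on {0..pi/2} dc_amplitude"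
    unfolding dc_phase_def dc_amplitude_def by (intro continuous_intros; simp)+
qed (auto intro: abs_dc_phase_less_1)

lemma num_tri_DC_eq_laplace_integral:
  assumes "k \<ge> 3"
  shows "real (num_tri_DC k) =
    4 / pi * 12 ^ (k - 2) * integral {0..pi/2} (\<lambda>t. dc_phase t ^ (k - 2) * dc_amplitude t)"
proof -
  have "x ^ (k - 2) * (x - 1) ^ k =
      12 ^ (k - 2) * ((x / 4 * (x - 1) / 3) ^ (k - 2) * (x - 1)\<^sup>2)" for x :: real
  proof -
    have "k = k - 2 + 2" using assms by simp
    then have "(x - 1) ^ k = (x - 1) ^ (k - 2) * (x - 1)\<^sup>2" by (metis power_add)
    moreover have "x ^ (k - 2) * (x - 1) ^ (k - 2) = (12 * (x / 4 * (x - 1) / 3)) ^ (k - 2)"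
      by (simp add: power_mult_distrib)
    ultimately show ?thesis by (simp only: power_mult_distrib mult.assoc[symmetric])
  qed
  then have "real (num_tri_DC k) =
      12 ^ (k - 2) * catalan_mean (\<lambda>x. (x / 4 * (x - 1) / 3) ^ (k - 2) * (x - 1)\<^sup>2)"
    unfolding num_tri_DC_eq_catalan_mean[OF assms] by (simp only: catalan_mean_cmult)
  then show ?thesis
    by (simp add: catalan_mean_def dc_phase_def dc_amplitude_def mult.assoc)
qed

lemma double_circle_constant:
  "4 / pi * (9 * (sqrt pi / (4 * (7/3) * sqrt (7/3)))) =
    54 / (7 * sqrt pi) * (sqrt 21 * (5 - sqrt 21) / (7 - sqrt 21)\<^sup>2)"
proof -
  have "sqrt (7/3) = sqrt (21/9)" by simp
  also have "\<dots> = sqrt 21 / 3" by (subst real_sqrt_divide) simp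
  finally have sqrt_7_3: "sqrt (7/3) = sqrt 21 / 3" .
  have "pi = sqrt pi * sqrt pi" by simp
  then have "4 / pi * (9 * (sqrt pi / (4 * (7/3) * sqrt (7/3)))) = 81 / (7 * sqrt 21 * sqrt pi)"
    unfolding sqrt_7_3 by (simp add: field_simps)
  also have "\<dots> = 54 / (7 * sqrt pi) * (sqrt 21 / 14)"
    by (simp add: field_simps)
  also have "sqrt 21 / 14 = sqrt 21 * (5 - sqrt 21) / (7 - sqrt 21)\<^sup>2"
  proof -
    have "sqrt 21 < 5" by (rule real_less_lsqrt) auto
    moreover have "(7 - sqrt 21)\<^sup>2 = 14 * (5 - sqrt 21)" by (simp add: power2_eq_square algebra_simps)
    ultimately show ?thesis by (simp only: mult_divide_mult_cancel_right)
  qed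
  finally show ?thesis .
qed

theorem theorem4p1:
  shows "(\<lambda>k. real (num_tri_DC k)) \<sim>[at_top]
    (\<lambda>k. 54 / (7 * sqrt pi) * (sqrt 21 * (5 - sqrt 21) / (7 - sqrt 21)^2)
          * 12 ^ (k - 2) * real k powr (-3/2))"
proof -
  interpret laplace_integral "pi/2" "7/3" 9 dc_phase dc_amplitude
    by (rule laplace_integral_double_circle)
  let ?I = "\<lambda>k. integral {0..pi/2} (\<lambda>t. dc_phase t ^ k * dc_amplitude t)"
  let ?c = "9 * (sqrt pi / (4 * (7/3) * sqrt (7/3)))"
  have "filterlim (\<lambda>k::nat. k - 2) at_top at_top" by real_asymp
  then have "(\<lambda>k. ?I (k - 2)) \<sim>[at_top] (\<lambda>k. ?c * real (k - 2) powr (-3/2))"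
    by (intro asymp_equiv_compose'[OF laplace_integral_asymp_equiv]) simp_all
  also have "\<dots> \<sim>[at_top] (\<lambda>k. ?c * real k powr (-3/2))"
    by (intro asymp_equiv_mult[OF asymp_equiv_refl]) real_asymp
  finally have "(\<lambda>k. 4 / pi * 12 ^ (k - 2) * ?I (k - 2)) \<sim>[at_top]
      (\<lambda>k. 4 / pi * 12 ^ (k - 2) * (?c * real k powr (-3/2)))"
    by (rule asymp_equiv_mult[OF asymp_equiv_refl])
  moreover have "(\<lambda>k. real (num_tri_DC k)) \<sim>[at_top] (\<lambda>k. 4 / pi * 12 ^ (k - 2) * ?I (k - 2))"
    using eventually_ge_at_top[of 3]
    by (rule asymp_equiv_refl_ev[OF eventually_mono]) (rule num_tri_DC_eq_laplace_integral)
  ultimately have "(\<lambda>k. real (num_tri_DC k)) \<sim>[at_top]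
      (\<lambda>k. 4 / pi * 12 ^ (k - 2) * (?c * real k powr (-3/2)))"
    by (rule asymp_equiv_trans[rotated])
  then show ?thesis unfolding double_circle_constant[symmetric] by (simp only: mult_ac)
qed

end
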